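(* Consider a Kronecker covariance filter with coefficients $h_{kr}\in\mathbb R$ ($0\le k\le K$, $1\le r\le 2T-1$) operating on the $2T-1$ stationary Kronecker pairs defined in the context. Suppose the spatial matrices of these pairs are estimated from $M>NT$ independent, zero-mean, sub-Gaussian observations $\tilde{\mathbf x}_1,\dots,\tilde{\mathbf x}_M\in\mathbb R^{NT}$ of a wide-sense stationary process, each observation being a stack of $T$ consecutive samples in $\mathbb R^N$. Let $(\mathbf A_r,\mathbf B_r)$ and $(\mathbf A_r,\hat{\mathbf B}_r)$ denote the pairs built from the true lagged covariances and from their sample estimates, respectively. Assume that, for each $r$, the frequency response $h_r(\gamma)=\sum_{k=0}^K h_{kr}\gamma^k$ is Lipschitz with constant $P$ on an interval $\mathcal I_r\subset\mathbb R$ containing the eigenvalues of both $\mathbf A_r\otimes\mathbf B_r$ and $\mathbf A_r\otimes\hat{\mathbf B}_r$, i.e. $|h_r(\gamma)-h_r(\gamma')|\le P|\gamma-\gamma'|$ for all $\gamma,\gamma'\in\mathcal I_r$. For an input signal $\tilde{\mathbf x}\in\mathbb R^{NT}$, let $$\mathbf u_0=\sum_{r=1}^{2T-1}\sum_{k=0}^K h_{kr}(\mathbf A_r^k\otimes\mathbf B_r^k)\tilde{\mathbf x},\qquad \mathbf u=\sum_{r=1}^{2T-1}\sum_{k=0}^K h_{kr}(\mathbf A_r^k\otimes\hat{\mathbf B}_r^k)\tilde{\mathbf x}$$ be the filter outputs on the true lagged covariances and on their sample estimates. Then $$\|\mathbf u_0-\mathbf u\|_2=\mathcal O_P\!\left(\frac{T^{3/2}PN}{\sqrt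 M}\right)\|\tilde{\mathbf x}\|_2 ,$$ where $\mathcal O_P$ indicates that the bound holds with probability increasing to $1$ as $M\to\infty$.
   Context: $\|\cdot\|_2$ is the Euclidean norm of a vector. $\otimes$ is the Kronecker product, and zeroth matrix powers are identities. Lagged covariances. For a zero-mean wide-sense stationary process $(\mathbf x_t)$ in $\mathbb R^N$, $\mathbb E[\mathbf x_{t_1}\mathbf x_{t_2}^\top]=\mathbf C_{t_1-t_2}$ depends only on $t_1-t_2$, and $\mathbf C_{-\tau}=\mathbf C_\tau^\top$. Stacking $T$ consecutive samples into one vector in $\mathbb R^{NT}$ gives a vector whose covariance matrix has $T\times T$ blocks of size $N\times N$, with block $(t_1,t_2)$, $0\le t_1,t_2\le T-1$, equal to $\mathbf C_{t_1-t_2}$. Sample estimates. $\tilde{\mathbf C}_s=\frac1M\sum_{t=1}^M\tilde{\mathbf x}_t\tilde{\mathbf x}_t^\top$ is the sample covariance of the stacked observations. For $\tau=0,\dots,T-1$, the sample estimate $\hat{\mathbf C}_\tau$ of $\mathbf C_\tau$ is the average of the $T-\tau$ blocks $(t_1,t_2)$ of $\tilde{\mathbf C}_s$ with $t_1-t_2=\tau$. Stationary Kronecker pairs. For $\tau=1,\dots,T-1$ let $\mathbf D_\tau\in\mathbb R^{T\times T}$ have entries $[\mathbf D_\tau]_{ij}=1$ if $j-i=\tau$ and $0$ otherwise. Put $\mathbf C_\tau^{s}=\frac12(\mathbf C_\tau+\mathbf C_\tau^\top)$ and $\mathbf C_\tau^{a}=\frac12(\mathbf C_\tau-\mathbf C_\tau^\top)$,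 and define $\hat{\mathbf C}_\tau^{s},\hat{\mathbf C}_\tau^{a}$ in the same way from $\hat{\mathbf C}_\tau$. The $2T-1$ pairs $(\mathbf A_r,\mathbf B_r)$ are $(\mathbf I_T,\mathbf C_0)$ and, for each $\tau=1,\dots,T-1$, $(\mathbf D_\tau+\mathbf D_\tau^\top,\ \mathbf C_\tau^{s})$ and $(\mathbf D_\tau^\top-\mathbf D_\tau,\ \mathbf C_\tau^{a})$. The pairs $(\mathbf A_r,\hat{\mathbf B}_r)$ are obtained by replacing $\mathbf C_0,\mathbf C_\tau^s,\mathbf C_\tau^a$ by $\hat{\mathbf C}_0,\hat{\mathbf C}_\tau^s,\hat{\mathbf C}_\tau^a$, with the same fixed temporal matrices $\mathbf A_r$. In each pair both factors are symmetric or both are skew-symmetric, so $\mathbf A_r\otimes\mathbf B_r$ and $\mathbf A_r\otimes\hat{\mathbf B}_r$ are real symmetric and have real eigenvalues. *)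

theory Defs
  imports
    "HOL-Probability.Probability"
    "Jordan_Normal_Form.Char_Poly"
begin

unbundle no vec_syntax
no_notation inner (infix \<open>\<bullet>\<close> 70)

type_synonym rvec = "real Matrix.vec"
type_synonym rmat = "real Matrix.mat"

definition l2_norm :: "rvec \<Rightarrow> real" where
  "l2_norm v = sqrt (v \<bullet> v)"

definition kron :: "rmat \<Rightarrow> rmat \<Rightarrow> rmat" (infixl \<open>\<otimes>\<^sub>k\<close> 70) where
  "A \<otimes>\<^sub>k B = mat (dim_row A * dim_row B) (dim_col A * dim_col B)
     (\<lambda>(i, j). A $$ (i div dim_row B, j div dim_col B) * B $$ (i mod dim_row B, j mod dim_col B))"


text \<open>Sample \<open>t\<close> of a stack occupies the coordinates \<open>t * N, \<dots>, t * N + N - 1\<close>, so that matrices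
  on stacked vectors are naturally of the form \<open>temporal \<otimes>\<^sub>k spatial\<close>.\<close>

definition stack :: "nat \<Rightarrow> nat \<Rightarrow> (nat \<Rightarrow> rvec) \<Rightarrow> rvec" where
  "stack N T y = Matrix.vec (N * T) (\<lambda>k. y (k div N) $ (k mod N))"

definition block :: "nat \<Rightarrow> rmat \<Rightarrow> nat \<Rightarrow> nat \<Rightarrow> rmat" where
  "block N S t1 t2 = mat N N (\<lambda>(i, j). S $$ (t1 * N + i, t2 * N + j))"


text \<open>Since \<open>t1\<close> and \<open>t2\<close> range over all integers, \<open>C (- \<tau>) = (C \<tau>)\<^sup>T\<close> is a consequence.\<close>

definition zero_mean_wss ::
    "'w measure \<Rightarrow> nat \<Rightarrow> (int \<Rightarrow> 'w \<Rightarrow> rvec) \<Rightarrow> (int \<Rightarrow> rmat) \<Rightarrow> bool" where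
  "zero_mean_wss \<Omega> N \<xi> C \<longleftrightarrow>
     (\<forall>\<tau>. C \<tau> \<in> carrier_mat N N) \<and>
     (\<forall>t. \<forall>\<omega>\<in>space \<Omega>. \<xi> t \<omega> \<in> carrier_vec N) \<and>
     (\<forall>t. \<forall>i<N. (\<lambda>\<omega>. \<xi> t \<omega> $ i) \<in> borel_measurable \<Omega> \<and>
        integrable \<Omega> (\<lambda>\<omega>. (\<xi> t \<omega> $ i)\<^sup>2) \<and>
        (\<integral>\<omega>. \<xi> t \<omega> $ i \<partial>\<Omega>) = 0) \<and>
     (\<forall>t1 t2. \<forall>i<N. \<forall>j<N.
        (\<integral>\<omega>. \<xi> t1 \<omega> $ i * \<xi> t2 \<omega> $ j \<partial>\<Omega>) = C (t1 - t2) $$ (i, j))"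

text \<open>Sub-Gaussianity of a zero-mean random vector with parameter \<open>\<sigma>\<close>, through the moment generating
  function of its marginals. Integrability is stated separately because the Bochner integral of a
  non-integrable function is \<open>0\<close>.\<close>

definition sub_gaussian :: "'w measure \<Rightarrow> nat \<Rightarrow> real \<Rightarrow> ('w \<Rightarrow> rvec) \<Rightarrow> bool" where
  "sub_gaussian \<Omega> n \<sigma> X \<longleftrightarrow>
     (\<forall>u\<in>carrier_vec n.
        integrable \<Omega> (\<lambda>\<omega>. exp (u \<bullet> X \<omega>)) \<and>
        (\<integral>\<omega>. exp (u \<bullet> X \<omega>) \<partial>\<Omega>) \<le> exp (\<sigma>\<^sup>2 * (l2_norm u)\<^sup>2 / 2))"

text \<open>The type of vectors carries no \<open>\<sigma>\<close>-algebra; vectors of dimension \<open>n\<close> are identified with the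
  product space of their coordinates.\<close>

definition indep_vecs :: "'w measure \<Rightarrow> nat \<Rightarrow> (nat \<Rightarrow> 'w \<Rightarrow> rvec) \<Rightarrow> nat set \<Rightarrow> bool" where
  "indep_vecs \<Omega> n X J \<longleftrightarrow>
     prob_space.indep_vars \<Omega> (\<lambda>_. PiM {..<n} (\<lambda>_. borel)) (\<lambda>m \<omega>. \<lambda>k\<in>{..<n}. X m \<omega> $ k) J"


definition sample_cov :: "nat \<Rightarrow> nat \<Rightarrow> (nat \<Rightarrow> rvec) \<Rightarrow> rmat" where
  "sample_cov n M x = mat n n (\<lambda>(i, j). (\<Sum>m=1..M. x m $ i * x m $ j) / real M)"

definition lag_estimate :: "nat \<Rightarrow> nat \<Rightarrow> rmat \<Rightarrow> nat \<Rightarrow> rmat" where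
  "lag_estimate N T S \<tau> = mat N N (\<lambda>(i, j).
     (\<Sum>(t1, t2)\<in>{(t1, t2). t1 < T \<and> t2 < T \<and> t1 = t2 + \<tau>}. block N S t1 t2 $$ (i, j)) / real (T - \<tau>))"


definition shift_mat :: "nat \<Rightarrow> nat \<Rightarrow> rmat" where
  "shift_mat T \<tau> = mat T T (\<lambda>(i, j). if j = i + \<tau> then 1 else 0)"

definition sym_part :: "rmat \<Rightarrow> rmat" where
  "sym_part A = (1 / 2) \<cdot>\<^sub>m (A + A\<^sup>T)"

definition skew_part :: "rmat \<Rightarrow> rmat" where
  "skew_part A = (1 / 2) \<cdot>\<^sub>m (A - A\<^sup>T)"

text \<open>The stationary Kronecker pairs are numbered \<open>r = 1, \<dots>, 2 * T - 1\<close>: pair \<open>1\<close> has lag \<open>0\<close>, and for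
  \<open>\<tau> = 1, \<dots>, T - 1\<close> the symmetric pair of lag \<open>\<tau>\<close> has number \<open>2 * \<tau>\<close> and the skew-symmetric one
  number \<open>2 * \<tau> + 1\<close>. The argument \<open>c\<close> lists the lagged covariances (true or estimated).\<close>

definition temporal :: "nat \<Rightarrow> nat \<Rightarrow> rmat" where
  "temporal T r =
     (let D = shift_mat T (r div 2)
      in if r = 1 then 1\<^sub>m T else if even r then D + D\<^sup>T else D\<^sup>T - D)"

definition spatial :: "(nat \<Rightarrow> rmat) \<Rightarrow> nat \<Rightarrow> rmat" where
  "spatial c r =
     (if r = 1 then c 0 else if even r then sym_part (c (r div 2)) else skew_part (c (r div 2)))"


definition freq_response :: "nat \<Rightarrow> (nat \<Rightarrow> nat \<Rightarrow> real) \<Rightarrow> nat \<Rightarrow> real \<Rightarrow> real" where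
  "freq_response K h r \<gamma> = (\<Sum>k\<le>K. h k r * \<gamma> ^ k)"

definition kron_filter ::
    "nat \<Rightarrow> nat \<Rightarrow> (nat \<Rightarrow> nat \<Rightarrow> real) \<Rightarrow> (nat \<Rightarrow> rmat) \<Rightarrow> (nat \<Rightarrow> rmat) \<Rightarrow> rvec \<Rightarrow> rvec" where
  "kron_filter K R h A B x = Matrix.vec (dim_vec x) (\<lambda>i.
     \<Sum>r=1..R. \<Sum>k\<le>K. h k r * (((A r ^\<^sub>m k) \<otimes>\<^sub>k (B r ^\<^sub>m k)) *\<^sub>v x) $ i)"

end

theory Submission
  imports Defs
begin

text \<open>For real symmetric matrices \<open>S\<close>, \<open>S'\<close> a scalar Lipschitz bound on \<open>h\<close> over both spectra carries
  over to the Frobenius norm: \<open>\<parallel>h(S) - h(S')\<parallel>\<^sub>F \<le> P \<parallel>S - S'\<parallel>\<^sub>F\<close>. Applied to \<open>S = A\<^sub>r \<otimes> B\<^sub>r\<close>, where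
  \<open>\<parallel>A\<^sub>r\<parallel>\<^sub>F\<^sup>2 \<le> 2 T\<close>, and summed over the \<open>2 T - 1\<close> pairs, this bounds the output error by
  \<open>\<surd>8 P T \<surd>Q \<parallel>x\<parallel>\<close>, where \<open>Q\<close> is the sum over the lags \<open>\<tau> < T\<close> of the squared Frobenius errors of the
  estimated covariances. Each of the \<open>T N\<^sup>2\<close> entries is an average of \<open>M\<close> independent terms whose second
  moment is at most a fourth-moment bound of order \<open>\<sigma>\<^sup>4\<close>, so \<open>E Q = O(T N\<^sup>2 / M)\<close>, and Markov's inequality
  gives the rate \<open>T\<^sup>3\<^sup>/\<^sup>2 N / \<surd>M\<close>. No independence between the samples within a stack is used, because
  averaging over the blocks of one lag does not increase the second moment.\<close>

section \<open>The spectral theorem for real symmetric matrices\<close>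

text \<open>Vectors are plain functions of which only the first \<open>n\<close> coordinates count.
  This keeps the sums free of carrier conditions and makes the product topology on functions
  available for the compactness argument below.\<close>

definition orthonormal_family :: "nat \<Rightarrow> nat \<Rightarrow> (nat \<Rightarrow> nat \<Rightarrow> real) \<Rightarrow> bool" where
  "orthonormal_family n k u \<longleftrightarrow>
     (\<forall>i<k. \<forall>j<k. (\<Sum>l<n. u i l * u j l) = (if i = j then 1 else 0))"

lemma sum_delta_lessThan:
  fixes f :: "nat \<Rightarrow> real"
  assumes "j < n"
  shows "(\<Sum>l<n. (if l = j then 1 else 0) * f l) = f j"
    and "(\<Sum>l<n. (if j = l then 1 else 0) * f l) = f j"
    and "(\<Sum>l<n. f l * (if l = j then 1 else 0)) = f j"
    and "(\<Sum>l<n. f l * (if j = l then 1 else 0)) = f j"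
  using assms by (simp_all add: if_distrib[of "\<lambda>x. x * _"] if_distrib[of "\<lambda>x. _ * x"] cong: if_cong)

lemma orthonormal_family_inner:
  assumes "orthonormal_family n k u" "i < k"
  shows "(\<Sum>l<n. u i l * (\<Sum>i'<k. c i' * u i' l)) = c i"
proof -
  have "(\<Sum>l<n. u i l * (\<Sum>i'<k. c i' * u i' l)) = (\<Sum>i'<k. c i' * (\<Sum>l<n. u i l * u i' l))"
    by (simp add: sum_distrib_left mult.left_commute sum.swap[of _ "{..<k}"])
  also have "\<dots> = (\<Sum>i'<k. c i' * (if i = i' then 1 else 0))"
    using assms by (intro sum.cong) (auto simp: orthonormal_family_def)
  finally show ?thesis
    using assms(2) sum_delta_lessThan by simp
qed

text \<open>The residual of the standard basis vector \<open>e\<^sub>j\<close> after projecting onto the span of \<open>u\<close>.\<close>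

definition residual :: "nat \<Rightarrow> (nat \<Rightarrow> nat \<Rightarrow> real) \<Rightarrow> nat \<Rightarrow> nat \<Rightarrow> real" where
  "residual k u j l = (if l = j then 1 else 0) - (\<Sum>i<k. u i j * u i l)"

lemma residual_orthogonal:
  assumes "orthonormal_family n k u" "i < k" "j < n"
  shows "(\<Sum>l<n. u i l * residual k u j l) = 0"
  using orthonormal_family_inner[OF assms(1,2), of "\<lambda>i. u i j"] assms(3)
  by (simp only: residual_def right_diff_distrib sum_subtractf sum_delta_lessThan)

text \<open>The residual is the image of a basis vector under an orthogonal projection, and a
  symmetric idempotent Q satisfies |Q e|^2 = e . Q e. Concretely, one factor of the square is
  expanded and its part in the span of \<open>u\<close> is orthogonal to the other factor.\<close>

lemma residual_norm:
  assumes "orthonormal_family n k u" "j < n"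
  shows "(\<Sum>l<n. (residual k u j l)\<^sup>2) = residual k u j j"
proof -
  have "(residual k u j l)\<^sup>2 = (if l = j then 1 else 0) * residual k u j l
      - (\<Sum>i<k. u i j * (u i l * residual k u j l))" for l
  proof -
    have "(\<Sum>i<k. u i j * (u i l * residual k u j l)) = (\<Sum>i<k. u i j * u i l) * residual k u j l"
      by (simp add: sum_distrib_right mult.assoc)
    then show ?thesis
      by (simp only: power2_eq_square flip: left_diff_distrib residual_def)
  qed
  then have "(\<Sum>l<n. (residual k u j l)\<^sup>2) =
      (\<Sum>l<n. (if l = j then 1 else 0) * residual k u j l)
      - (\<Sum>i<k. u i j * (\<Sum>l<n. u i l * residual k u j l))"
    by (simp only: sum_subtractf sum_distrib_left sum.swap[of _ "{..<k}"])
  also have "\<dots> = residual k u j j"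
    using residual_orthogonal[OF assms(1) _ assms(2)] by (simp only: sum_delta_lessThan assms(2)) simp
  finally show ?thesis .
qed

text \<open>This is the trace of the projection onto the complement: the trace of the identity minus
  one for each of the \<open>k\<close> unit vectors.\<close>

lemma residual_sum:
  assumes "orthonormal_family n k u"
  shows "(\<Sum>j<n. residual k u j j) = real n - real k"
proof -
  have "(\<Sum>j<n. residual k u j j) = real n - (\<Sum>i<k. \<Sum>j<n. u i j * u i j)"
    by (simp add: residual_def sum_subtractf sum.swap[of _ "{..<k}"])
  also have "(\<Sum>i<k. \<Sum>j<n. u i j * u i j) = (\<Sum>i<k. 1)"
    using assms by (intro sum.cong) (auto simp: orthonormal_family_def)
  finally show ?thesis by simp
qed

text \<open>A square matrix with orthonormal rows has orthonormal columns: for \<open>k = n\<close>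
  the squared norms of all residuals add up to n - n = 0, so every entry of every residual
  vanishes.\<close>

lemma orthonormal_basis_complete:
  assumes "orthonormal_family n n u" "a < n" "b < n"
  shows "(\<Sum>i<n. u i a * u i b) = (if a = b then 1 else 0)"
proof -
  have "(\<Sum>j<n. \<Sum>l<n. (residual n u j l)\<^sup>2) = 0"
    using residual_sum[OF assms(1)] residual_norm[OF assms(1)] by simp
  then have "(residual n u a b)\<^sup>2 = 0"
    using assms(2,3) by (subst (asm) sum_nonneg_eq_0_iff)
      (auto intro!: sum_nonneg simp: sum_nonneg_eq_0_iff)
  then show ?thesis by (auto simp: residual_def)
qed

text \<open>The diagonal residuals sum to n - k > 0, so one of them is positive, and it is the
  squared norm of its residual.\<close>

lemma orthonormal_family_extend:
  assumes "orthonormal_family n k u" "k < n"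
  obtains w where "\<And>i. i < k \<Longrightarrow> (\<Sum>l<n. u i l * w l) = 0" "(\<Sum>l<n. (w l)\<^sup>2) > 0"
proof -
  have "\<exists>j<n. residual k u j j > 0"
  proof (rule ccontr)
    assume "\<not> ?thesis"
    then have "(\<Sum>j<n. residual k u j j) \<le> 0" by (intro sum_nonpos) auto
    then show False using residual_sum[OF assms(1)] assms(2) by simp
  qed
  then obtain j where "j < n" "residual k u j j > 0" by blast
  then show ?thesis
    using that[of "residual k u j"] residual_orthogonal[OF assms(1)] residual_norm[OF assms(1)]
    by simp
qed

text \<open>The quadratic form is continuous and attains its minimum over the compact unit sphere of
  the complement. Both sides of the last inequality are homogeneous of degree two, which carries it
  from unit vectors to all \<open>w\<close>.\<close>

lemma rayleigh_minimizer_on_complement: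
  fixes a :: "nat \<Rightarrow> nat \<Rightarrow> real"
  assumes "orthonormal_family n k u" "k < n"
  obtains v m where "\<And>i. i < k \<Longrightarrow> (\<Sum>l<n. u i l * v l) = 0" "(\<Sum>l<n. (v l)\<^sup>2) = 1"
    "(\<Sum>p<n. \<Sum>q<n. v p * a p q * v q) = m"
    "\<And>w. (\<And>i. i < k \<Longrightarrow> (\<Sum>l<n. u i l * w l) = 0) \<Longrightarrow>
       m * (\<Sum>l<n. (w l)\<^sup>2) \<le> (\<Sum>p<n. \<Sum>q<n. w p * a p q * w q)"
proof -
  define R where "R = (\<lambda>f. \<Sum>p<n. \<Sum>q<n. f p * a p q * f q)"
  define V where "V = {f. \<forall>i<k. (\<Sum>l<n. u i l * f l) = 0}"
  define S where "S = {f. (\<Sum>l<n. (f l)\<^sup>2) = 1} \<inter> V"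
  \<comment> \<open>Pinning the coordinates \<open>\<ge> n\<close> to \<open>0\<close> makes the unit sphere compact in the product topology.\<close>
  define box :: "(nat \<Rightarrow> real) set" where
    "box = PiE UNIV (\<lambda>l. if l < n then {-1..1} else {0})"
  have coord: "continuous_on A (\<lambda>f::nat \<Rightarrow> real. f l)" for A l
    using continuous_on_product_coordinates by (rule continuous_on_subset) auto
  \<comment> \<open>Only coordinates below \<open>n\<close> enter the form, the norm and the
    constraints, so the others can be set to 0 and the vector rescaled without leaving the
    complement.\<close>
  have normalize: "\<exists>f\<in>S \<inter> box. R f = R w / (\<Sum>l<n. (w l)\<^sup>2)"
    if "w \<in> V" and pos: "(\<Sum>l<n. (w l)\<^sup>2) > 0" for w
  proof -
    define s where "s = sqrt (\<Sum>l<n. (w l)\<^sup>2)"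
    define f where "f = (\<lambda>l. if l < n then w l / s else 0)"
    have s: "s > 0" "s\<^sup>2 = (\<Sum>l<n. (w l)\<^sup>2)" using pos by (simp_all add: s_def)
    have sq: "(\<Sum>l<n. (f l)\<^sup>2) = 1"
      using s pos by (simp add: f_def power_divide flip: sum_divide_distrib)
    have "(\<Sum>l<n. u i l * f l) = (\<Sum>l<n. u i l * w l) / s" for i
      by (simp add: f_def sum_divide_distrib)
    then have "f \<in> V" using that(1) by (simp add: V_def)
    moreover have "\<bar>f l\<bar> \<le> 1" if "l < n" for l
    proof -
      have "(f l)\<^sup>2 \<le> (\<Sum>l<n. (f l)\<^sup>2)"
        using that by (intro member_le_sum) auto
      then show ?thesis using sq abs_square_le_1[of "f l"] by simp
    qed
    then have "f \<in> box"
      by (auto simp: box_def f_def abs_le_iff[of "_ / s"] simp del: abs_divide)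
    moreover have "R f = R w / s\<^sup>2"
      by (simp add: R_def f_def sum_divide_distrib power2_eq_square)
    ultimately show ?thesis using sq s(2) by (auto simp: S_def)
  qed
  have "compactin (product_topology (\<lambda>_. euclidean) UNIV) box"
    unfolding box_def compactin_PiE by auto
  then have "compact box" by (simp add: euclidean_product_topology)
  moreover have "closed S"
  proof -
    have "closed {f. (\<Sum>l<n. (f l :: real)\<^sup>2) = 1}"
      by (intro closed_Collect_eq continuous_intros coord)
    moreover have "V = (\<Inter>i<k. {f. (\<Sum>l<n. u i l * f l) = 0})"
      by (auto simp: V_def)
    moreover have "closed {f. (\<Sum>l<n. u i l * f l) = 0}" for i
      by (intro closed_Collect_eq continuous_intros coord)
    ultimately show ?thesis by (auto simp: S_def)
  qed
  ultimately have "compact (S \<inter> box)"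
    by (simp add: closed_Int_compact)
  moreover obtain w0 where "w0 \<in> V" "(\<Sum>l<n. (w0 l)\<^sup>2) > 0"
    using orthonormal_family_extend[OF assms] by (force simp: V_def)
  then have "S \<inter> box \<noteq> {}" using normalize by blast
  moreover have "continuous_on (S \<inter> box) R"
    unfolding R_def by (intro continuous_intros coord)
  ultimately obtain v where v: "v \<in> S \<inter> box" "\<And>f. f \<in> S \<inter> box \<Longrightarrow> R v \<le> R f"
    using continuous_attains_inf by metis
  show ?thesis
  proof (rule that[of v "R v"])
    fix w assume "\<And>i. i < k \<Longrightarrow> (\<Sum>l<n. u i l * w l) = 0"
    then have w: "w \<in> V" by (simp add: V_def)
    show "R v * (\<Sum>l<n. (w l)\<^sup>2) \<le> (\<Sum>p<n. \<Sum>q<n. w p * a p q * w q)"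
    proof (cases "(\<Sum>l<n. (w l)\<^sup>2) > 0")
      case True
      then have "R v \<le> R w / (\<Sum>l<n. (w l)\<^sup>2)"
        using normalize[OF w] v(2) by metis
      then show ?thesis using True by (simp add: R_def field_simps)
    next
      \<comment> \<open>Here all coordinates of \<open>w\<close> below \<open>n\<close> vanish and
        both sides are 0.\<close>
      case False
      moreover have "(\<Sum>l<n. (w l)\<^sup>2) \<ge> 0" by (intro sum_nonneg) auto
      ultimately have "(\<Sum>l<n. (w l)\<^sup>2) = 0" by simp
      then show ?thesis by (simp add: sum_nonneg_eq_0_iff)
    qed
  qed (use v(1) in \<open>auto simp: S_def V_def R_def\<close>)
qed

text \<open>Induction on the number of eigenvectors: a minimizer of the Rayleigh quotient on the
  complement of the earlier ones is a new eigenvector. By symmetry the complement is invariant, so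
  the defect of the eigenvalue equation is an admissible direction of variation.\<close>

lemma orthonormal_eigenvectors:
  fixes a :: "nat \<Rightarrow> nat \<Rightarrow> real"
  assumes sym: "\<And>p q. p < n \<Longrightarrow> q < n \<Longrightarrow> a p q = a q p"
  assumes "k \<le> n"
  shows "\<exists>u m. orthonormal_family n k u \<and> (\<forall>i<k. \<forall>p<n. (\<Sum>q<n. a p q * u i q) = m i * u i p)"
  using assms(2)
proof (induction k)
  case 0
  show ?case by (simp add: orthonormal_family_def)
next
  case (Suc k)
  then obtain u m where u: "orthonormal_family n k u"
    and eig: "\<And>i p. i < k \<Longrightarrow> p < n \<Longrightarrow> (\<Sum>q<n. a p q * u i q) = m i * u i p"
    by force
  obtain v \<mu> where v: "\<And>i. i < k \<Longrightarrow> (\<Sum>l<n. u i l * v l) = 0" "(\<Sum>l<n. (v l)\<^sup>2) = 1"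
    and \<mu>: "(\<Sum>p<n. \<Sum>q<n. v p * a p q * v q) = \<mu>"
    and min: "\<And>w. (\<And>i. i < k \<Longrightarrow> (\<Sum>l<n. u i l * w l) = 0) \<Longrightarrow>
       \<mu> * (\<Sum>l<n. (w l)\<^sup>2) \<le> (\<Sum>p<n. \<Sum>q<n. w p * a p q * w q)"
    using rayleigh_minimizer_on_complement[OF u, where a = a] Suc.prems by auto
  \<comment> \<open>\<open>z\<close> is the defect of the eigenvalue equation at \<open>v\<close>,
    \<open>s\<close> its squared norm, and \<open>r\<close> the amount by which the form at
    \<open>z\<close> exceeds its lower bound \<open>\<mu> * s\<close>.\<close>
  define z where "z = (\<lambda>p. (\<Sum>q<n. a p q * v q) - \<mu> * v p)"
  define s where "s = (\<Sum>l<n. (z l)\<^sup>2)"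
  define r where "r = (\<Sum>p<n. \<Sum>q<n. z p * a p q * z q) - \<mu> * s"
  have z_orth: "(\<Sum>l<n. u i l * z l) = 0" if "i < k" for i
  proof -
    have "(\<Sum>p<n. u i p * (\<Sum>q<n. a p q * v q)) = (\<Sum>q<n. (\<Sum>p<n. a q p * u i p) * v q)"
      unfolding sum_distrib_left sum_distrib_right
      by (subst sum.swap) (auto intro!: sum.cong simp: sym)
    also have "\<dots> = m i * (\<Sum>q<n. u i q * v q)"
      using that by (simp add: eig sum_distrib_left mult.assoc)
    finally have "(\<Sum>p<n. u i p * (\<Sum>q<n. a p q * v q)) = 0" using v(1) that by simp
    moreover have "(\<Sum>l<n. u i l * z l) =
        (\<Sum>p<n. u i p * (\<Sum>q<n. a p q * v q)) - \<mu> * (\<Sum>p<n. u i p * v p)"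
      by (simp add: z_def algebra_simps sum_subtractf sum_distrib_left)
    ultimately show ?thesis using v(1) that by simp
  qed
  \<comment> \<open>First variation of the Rayleigh quotient at \<open>v\<close> in the direction of the defect \<open>z\<close>.\<close>
  have quad: "0 \<le> 2 * t * s + t\<^sup>2 * r" for t
  proof -
    have cross: "(\<Sum>p<n. \<Sum>q<n. z p * a p q * v q) = s + \<mu> * (\<Sum>l<n. z l * v l)"
      by (simp add: s_def z_def power2_eq_square sum_distrib_left algebra_simps sum_subtractf
          flip: sum.distrib)
    have cross': "(\<Sum>p<n. \<Sum>q<n. v p * a p q * z q) = (\<Sum>p<n. \<Sum>q<n. z p * a p q * v q)"
      by (subst sum.swap) (auto intro!: sum.cong simp: sym)
    have "(\<Sum>l<n. u i l * (v l + t * z l)) = 0" if "i < k" for i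
    proof -
      have "(\<Sum>l<n. u i l * (v l + t * z l)) = (\<Sum>l<n. u i l * v l) + t * (\<Sum>l<n. u i l * z l)"
        by (simp add: algebra_simps sum.distrib sum_distrib_left)
      then show ?thesis using v(1) z_orth that by simp
    qed
    from min[OF this] have "\<mu> * (\<Sum>l<n. (v l + t * z l)\<^sup>2) \<le>
      (\<Sum>p<n. \<Sum>q<n. (v p + t * z p) * a p q * (v q + t * z q))" by blast
    moreover have "(\<Sum>l<n. (v l + t * z l)\<^sup>2) = 1 + 2 * t * (\<Sum>l<n. z l * v l) + t\<^sup>2 * s"
      unfolding v(2)[symmetric] s_def
      by (simp add: power2_eq_square algebra_simps sum.distrib sum_distrib_left)
    moreover have "(\<Sum>p<n. \<Sum>q<n. (v p + t * z p) * a p q * (v q + t * z q)) =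
        (\<Sum>p<n. \<Sum>q<n. v p * a p q * v q) + t * (\<Sum>p<n. \<Sum>q<n. z p * a p q * v q)
        + t * (\<Sum>p<n. \<Sum>q<n. v p * a p q * z q) + t\<^sup>2 * (\<Sum>p<n. \<Sum>q<n. z p * a p q * z q)"
      by (simp add: power2_eq_square algebra_simps sum.distrib sum_distrib_left)
    ultimately show ?thesis
      unfolding cross' cross \<mu> r_def by (simp add: algebra_simps)
  qed
  have "s \<ge> 0" unfolding s_def by (intro sum_nonneg) auto
  have "r \<ge> 0" using min[OF z_orth] by (simp add: r_def s_def)
  have "s = 0"
  proof -
    \<comment> \<open>A quadratic in \<open>t\<close> that is nonnegative and has no constant term
      must have linear coefficient 0. The denominator \<open>r + 1\<close> stays positive for
      \<open>r = 0\<close>, and this \<open>t\<close> gives the quadratic the value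
      \<open>- (t\<^sup>2 * (r + 2))\<close>.\<close>
    define t where "t = - s / (r + 1)"
    have s_eq: "s = - t * (r + 1)" using \<open>r \<ge> 0\<close> by (simp add: t_def)
    have "2 * t * s + t\<^sup>2 * r = - (t\<^sup>2 * (r + 2))"
      by (subst s_eq) (simp add: algebra_simps power2_eq_square)
    then have "t\<^sup>2 * (r + 2) \<le> 0" using quad[of t] by simp
    then have "t = 0" using \<open>r \<ge> 0\<close> by (simp add: mult_le_0_iff)
    then show ?thesis using s_eq by simp
  qed
  then have z0: "z p = 0" if "p < n" for p
    using that by (auto simp: s_def sum_nonneg_eq_0_iff)
  define u' where "u' = u(k := v)"
  define m' where "m' = m(k := \<mu>)"
  have "orthonormal_family n (Suc k) u'"
    using u v unfolding orthonormal_family_def u'_def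
    by (auto simp: less_Suc_eq power2_eq_square mult.commute)
  moreover have "(\<Sum>q<n. a p q * u' i q) = m' i * u' i p" if "i < Suc k" "p < n" for i p
    using eig z0 that by (auto simp: u'_def m'_def z_def less_Suc_eq)
  ultimately show ?case by blast
qed

text \<open>The expansion of the entries follows by substituting the eigenvalue equation into the
  sum and using that the columns of \<open>u\<close> are orthonormal as well.\<close>

lemma spectral_theorem_symmetric:
  fixes a :: "nat \<Rightarrow> nat \<Rightarrow> real"
  assumes "\<And>p q. p < n \<Longrightarrow> q < n \<Longrightarrow> a p q = a q p"
  obtains u m where "orthonormal_family n n u"
    "\<And>i p. i < n \<Longrightarrow> p < n \<Longrightarrow> (\<Sum>q<n. a p q * u i q) = m i * u i p"
    "\<And>p q. p < n \<Longrightarrow> q < n \<Longrightarrow> a p q = (\<Sum>i<n. m i * u i p * u i q)"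
proof -
  obtain u m where u: "orthonormal_family n n u"
    and eig: "\<And>i p. i < n \<Longrightarrow> p < n \<Longrightarrow> (\<Sum>q<n. a p q * u i q) = m i * u i p"
    using orthonormal_eigenvectors[OF assms, of n] by force
  have "a p q = (\<Sum>i<n. m i * u i p * u i q)" if "p < n" "q < n" for p q
  proof -
    have "(\<Sum>i<n. m i * u i p * u i q) = (\<Sum>i<n. (\<Sum>l<n. a p l * u i l) * u i q)"
      using eig that by simp
    also have "\<dots> = (\<Sum>l<n. a p l * (\<Sum>i<n. u i l * u i q))"
      unfolding sum_distrib_left sum_distrib_right by (subst sum.swap) (simp add: mult.assoc)
    also have "\<dots> = (\<Sum>l<n. a p l * (if l = q then 1 else 0))"
      using that by (intro sum.cong) (auto simp: orthonormal_basis_complete[OF u])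
    also have "\<dots> = a p q" using that sum_delta_lessThan by simp
    finally show ?thesis by simp
  qed
  then show ?thesis using that u eig by blast
qed

section \<open>Lipschitz continuity of matrix polynomials in the Frobenius norm\<close>

lemma parseval:
  assumes "orthonormal_family n n u"
  shows "(\<Sum>i<n. (\<Sum>l<n. u i l * f l)\<^sup>2) = (\<Sum>l<n. (f l)\<^sup>2)"
proof -
  have "(\<Sum>i<n. (\<Sum>l<n. u i l * f l)\<^sup>2) = (\<Sum>i<n. \<Sum>l<n. \<Sum>l'<n. u i l * u i l' * (f l * f l'))"
    by (simp add: power2_eq_square sum_product algebra_simps)
  also have "\<dots> = (\<Sum>l<n. \<Sum>l'<n. \<Sum>i<n. u i l * u i l' * (f l * f l'))"
    by (subst sum.swap, rule sum.cong[OF refl], rule sum.swap)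
  also have "\<dots> = (\<Sum>l<n. \<Sum>l'<n. (if l = l' then 1 else 0) * (f l * f l'))"
    by (simp add: orthonormal_basis_complete[OF assms] flip: sum_distrib_right)
  finally show ?thesis
    by (simp add: sum_delta_lessThan power2_eq_square)
qed

text \<open>Parseval applied once in each index. The bases on the two sides may differ, which is
  what a comparison of matrices with different eigenvectors requires.\<close>

lemma frobenius_change_of_basis:
  assumes "orthonormal_family n n u" "orthonormal_family n n v"
  shows "(\<Sum>a<n. \<Sum>b<n. (d a b)\<^sup>2) =
    (\<Sum>i<n. \<Sum>j<n. (\<Sum>b<n. v j b * (\<Sum>a<n. u i a * d a b))\<^sup>2)"
proof -
  have "(\<Sum>i<n. \<Sum>j<n. (\<Sum>b<n. v j b * (\<Sum>a<n. u i a * d a b))\<^sup>2) =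
      (\<Sum>i<n. \<Sum>b<n. (\<Sum>a<n. u i a * d a b)\<^sup>2)"
    by (rule sum.cong[OF refl], rule parseval[OF assms(2)])
  also have "\<dots> = (\<Sum>b<n. \<Sum>i<n. (\<Sum>a<n. u i a * d a b)\<^sup>2)"
    by (rule sum.swap)
  also have "\<dots> = (\<Sum>b<n. \<Sum>a<n. (d a b)\<^sup>2)"
    by (rule sum.cong[OF refl], rule parseval[OF assms(1)])
  also have "\<dots> = (\<Sum>a<n. \<Sum>b<n. (d a b)\<^sup>2)"
    by (rule sum.swap)
  finally show ?thesis by simp
qed

text \<open>In the mixed basis the difference has entries (f_i - g_j) times the inner product of u_i
  and v_j. These inner products do not depend on \<open>f\<close> and \<open>g\<close>, so different
  choices of \<open>f\<close> and \<open>g\<close> can be compared term by term.\<close>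

lemma frobenius_spectral_difference:
  assumes u: "orthonormal_family n n u" and v: "orthonormal_family n n v"
    and d: "\<And>a b. a < n \<Longrightarrow> b < n \<Longrightarrow>
      d a b = (\<Sum>i<n. f i * u i a * u i b) - (\<Sum>j<n. g j * v j a * v j b)"
  shows "(\<Sum>a<n. \<Sum>b<n. (d a b)\<^sup>2) = (\<Sum>i<n. \<Sum>j<n. ((f i - g j) * (\<Sum>l<n. u i l * v j l))\<^sup>2)"
proof (subst frobenius_change_of_basis[OF u v], intro sum.cong refl arg_cong[of _ _ "\<lambda>x. x\<^sup>2"])
  fix i j assume "i \<in> {..<n}" "j \<in> {..<n}"
  then have ij: "i < n" "j < n" by simp_all
  have "(\<Sum>a<n. u i a * d a b) =
      f i * u i b - (\<Sum>j'<n. g j' * (\<Sum>a<n. u i a * v j' a) * v j' b)" if "b < n" for b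
  proof -
    have "(\<Sum>a<n. u i a * d a b) = (\<Sum>a<n. u i a * (\<Sum>i'<n. (f i' * u i' b) * u i' a))
        - (\<Sum>a<n. u i a * (\<Sum>j'<n. g j' * v j' a * v j' b))"
      using that by (simp add: d right_diff_distrib sum_subtractf mult.commute mult.left_commute)
    also have "(\<Sum>a<n. u i a * (\<Sum>j'<n. g j' * v j' a * v j' b)) =
        (\<Sum>j'<n. g j' * (\<Sum>a<n. u i a * v j' a) * v j' b)"
      unfolding sum_distrib_left sum_distrib_right by (subst sum.swap) (simp add: mult_ac)
    finally show ?thesis using orthonormal_family_inner[OF u ij(1)] by simp
  qed
  then have "(\<Sum>b<n. v j b * (\<Sum>a<n. u i a * d a b)) = (\<Sum>b<n. f i * (u i b * v j b))
      - (\<Sum>b<n. v j b * (\<Sum>j'<n. (g j' * (\<Sum>a<n. u i a * v j' a)) * v j' b))"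
    by (simp add: right_diff_distrib sum_subtractf mult_ac)
  then show "(\<Sum>b<n. v j b * (\<Sum>a<n. u i a * d a b)) = (f i - g j) * (\<Sum>l<n. u i l * v j l)"
    unfolding orthonormal_family_inner[OF v ij(2)]
    by (simp add: left_diff_distrib flip: sum_distrib_left)
qed

lemma matrix_vector_le_frobenius:
  fixes d :: "nat \<Rightarrow> nat \<Rightarrow> real"
  shows "(\<Sum>a<n. (\<Sum>b<n. d a b * x b)\<^sup>2) \<le> (\<Sum>a<n. \<Sum>b<n. (d a b)\<^sup>2) * (\<Sum>b<n. (x b)\<^sup>2)"
  unfolding sum_distrib_right[of "\<lambda>a. \<Sum>b<n. (d a b)\<^sup>2"]
  by (intro sum_mono Cauchy_Schwarz_ineq_sum)

section \<open>Powers and eigenbases of symmetric matrices\<close>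

lemma scalar_prod_sum_lessThan:
  "w \<in> carrier_vec n \<Longrightarrow> v \<bullet> w = (\<Sum>i<n. v $ i * w $ i)"
  by (simp add: scalar_prod_def lessThan_atLeast0)

lemma mult_mat_index_sum:
  assumes "A \<in> carrier_mat m n" "B \<in> carrier_mat n p" "i < m" "j < p"
  shows "(A * B) $$ (i, j) = (\<Sum>k<n. A $$ (i, k) * B $$ (k, j))"
  using assms by (auto simp: scalar_prod_sum_lessThan[where n = n] intro!: sum.cong)

lemma mult_mat_vec_index_sum:
  assumes "A \<in> carrier_mat m n" "x \<in> carrier_vec n" "i < m"
  shows "(A *\<^sub>v x) $ i = (\<Sum>k<n. A $$ (i, k) * x $ k)"
  using assms by (auto simp: scalar_prod_sum_lessThan[where n = n] intro!: sum.cong)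

text \<open>The eigenvalue equation is assumed with the row index summed, matching the right
  multiplication by \<open>S\<close> in the recursion for powers. The case \<open>k = 0\<close> is
  completeness of the basis.\<close>

lemma pow_mat_spectral:
  fixes S :: rmat
  assumes S: "S \<in> carrier_mat n n" and u: "orthonormal_family n n u"
    and eig: "\<And>i p. i < n \<Longrightarrow> p < n \<Longrightarrow> (\<Sum>q<n. S $$ (q, p) * u i q) = m i * u i p"
    and "p < n" "q < n"
  shows "(S ^\<^sub>m k) $$ (p, q) = (\<Sum>i<n. m i ^ k * u i p * u i q)"
  using assms(4,5)
proof (induction k arbitrary: q)
  case 0
  then show ?case using S orthonormal_basis_complete[OF u] by simp
next
  case (Suc k)
  have "(S ^\<^sub>m Suc k) $$ (p, q) = (\<Sum>l<n. (\<Sum>i<n. m i ^ k * u i p * u i l) * S $$ (l, q))"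
    using Suc by (simp add: mult_mat_index_sum[OF pow_carrier_mat[OF S] S] del: index_mult_mat)
  also have "\<dots> = (\<Sum>i<n. m i ^ k * u i p * (\<Sum>l<n. S $$ (l, q) * u i l))"
    unfolding sum_distrib_left sum_distrib_right by (subst sum.swap) (simp add: mult_ac)
  also have "\<dots> = (\<Sum>i<n. m i ^ k * u i p * (m i * u i q))"
    using Suc.prems by (simp add: eig)
  also have "\<dots> = (\<Sum>i<n. m i ^ Suc k * u i p * u i q)"
    by (simp add: mult_ac)
  finally show ?case .
qed

definition symmetric_mat :: "rmat \<Rightarrow> bool" where
  "symmetric_mat S \<longleftrightarrow> S\<^sup>T = S"

lemma symmetric_mat_index:
  assumes "symmetric_mat S" "S \<in> carrier_mat n n" "i < n" "j < n"
  shows "S $$ (i, j) = S $$ (j, i)"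
  using assms index_transpose_mat(1)[of i S j] by (simp add: symmetric_mat_def)

text \<open>One basis serves all powers at once. The values \<open>m i\<close> are shown to satisfy
  \<open>eigenvalue\<close>, so that hypotheses on the spectrum apply to them; unit norm makes the
  eigenvectors nonzero.\<close>

lemma symmetric_mat_eigenbasis:
  assumes S: "S \<in> carrier_mat n n" and "symmetric_mat S"
  obtains u m where "orthonormal_family n n u" "\<And>i. i < n \<Longrightarrow> eigenvalue S (m i)"
    "\<And>k p q. p < n \<Longrightarrow> q < n \<Longrightarrow> (S ^\<^sub>m k) $$ (p, q) = (\<Sum>i<n. m i ^ k * u i p * u i q)"
proof -
  note sym = symmetric_mat_index[OF assms(2) S]
  obtain u m where u: "orthonormal_family n n u"
    and eig: "\<And>i p. i < n \<Longrightarrow> p < n \<Longrightarrow> (\<Sum>q<n. S $$ (p, q) * u i q) = m i * u i p"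
    using spectral_theorem_symmetric[where n = n and a = "\<lambda>p q. S $$ (p, q)", OF sym]
    by metis
  have "eigenvalue S (m i)" if "i < n" for i
  proof -
    define v where "v = Matrix.vec n (u i)"
    have v: "v \<in> carrier_vec n" by (simp add: v_def)
    have "S *\<^sub>v v = m i \<cdot>\<^sub>v v"
    proof (rule eq_vecI)
      fix p assume "p < dim_vec (m i \<cdot>\<^sub>v v)"
      then have "p < n" by (simp add: v_def)
      then show "(S *\<^sub>v v) $ p = (m i \<cdot>\<^sub>v v) $ p"
        using that mult_mat_vec_index_sum[OF S v] eig by (simp add: v_def)
    qed (use S in \<open>simp add: v_def\<close>)
    moreover have "v \<noteq> 0\<^sub>v n"
    proof
      assume "v = 0\<^sub>v n"
      then have "u i l = 0" if "l < n" for l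
        using that by (metis index_vec index_zero_vec(1) v_def)
      then have "(\<Sum>l<n. u i l * u i l) = 0" by simp
      then show False using u that by (simp add: orthonormal_family_def)
    qed
    ultimately show ?thesis
      using S v by (auto simp: eigenvalue_def eigenvector_def)
  qed
  moreover have "(\<Sum>q<n. S $$ (q, p) * u i q) = m i * u i p" if "i < n" "p < n" for i p
    using eig[OF that] sym that by simp
  ultimately show ?thesis
    using that[OF u] pow_mat_spectral[OF S u] by blast
qed

text \<open>Expanding in the eigenbases of both matrices turns the Frobenius norms of the differences into
  weighted sums over pairs of eigenvalues with the same weights, so that the scalar Lipschitz
  bound applies pair by pair; no commutation is needed.\<close>

lemma polynomial_filter_lipschitz:
  fixes S S' :: rmat
  assumes S: "S \<in> carrier_mat n n" "symmetric_mat S"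
    and S': "S' \<in> carrier_mat n n" "symmetric_mat S'"
    and eig: "{\<gamma>. eigenvalue S \<gamma>} \<subseteq> I" "{\<gamma>. eigenvalue S' \<gamma>} \<subseteq> I"
    and lip: "P-lipschitz_on I (\<lambda>\<gamma>. \<Sum>k\<le>K. c k * \<gamma> ^ k)"
    and x: "x \<in> carrier_vec n"
  shows "(\<Sum>a<n. ((\<Sum>k\<le>K. c k * (S ^\<^sub>m k *\<^sub>v x) $ a) - (\<Sum>k\<le>K. c k * (S' ^\<^sub>m k *\<^sub>v x) $ a))\<^sup>2)
    \<le> P\<^sup>2 * (\<Sum>a<n. \<Sum>b<n. (S $$ (a, b) - S' $$ (a, b))\<^sup>2) * (x \<bullet> x)"
proof -
  define h where "h = (\<lambda>\<gamma>. \<Sum>k\<le>K. c k * \<gamma> ^ k)"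
  obtain u m where u: "orthonormal_family n n u" "\<And>i. i < n \<Longrightarrow> eigenvalue S (m i)"
    and um: "\<And>k p q. p < n \<Longrightarrow> q < n \<Longrightarrow> (S ^\<^sub>m k) $$ (p, q) = (\<Sum>i<n. m i ^ k * u i p * u i q)"
    using that by (rule symmetric_mat_eigenbasis[OF S])
  obtain v l where v: "orthonormal_family n n v" "\<And>i. i < n \<Longrightarrow> eigenvalue S' (l i)"
    and vl: "\<And>k p q. p < n \<Longrightarrow> q < n \<Longrightarrow> (S' ^\<^sub>m k) $$ (p, q) = (\<Sum>i<n. l i ^ k * v i p * v i q)"
    using that by (rule symmetric_mat_eigenbasis[OF S'])
  \<comment> \<open>\<open>H m u\<close> collects the entries of the polynomial \<open>h\<close>
    applied to the matrix with eigenvalues \<open>m\<close> and eigenvectors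
    \<open>u\<close>.\<close>
  define H where "H = (\<lambda>(m :: nat \<Rightarrow> real) (u :: nat \<Rightarrow> nat \<Rightarrow> real) a b. \<Sum>i<n. h (m i) * u i a * u i b)"
  have filter: "(\<Sum>k\<le>K. c k * (R ^\<^sub>m k *\<^sub>v x) $ a) = (\<Sum>b<n. H m u a b * x $ b)"
    if R: "R \<in> carrier_mat n n" and "a < n"
      and um: "\<And>k p q. p < n \<Longrightarrow> q < n \<Longrightarrow> (R ^\<^sub>m k) $$ (p, q) = (\<Sum>i<n. m i ^ k * u i p * u i q)"
    for R m u a
  proof -
    have "(\<Sum>k\<le>K. c k * (R ^\<^sub>m k *\<^sub>v x) $ a) = (\<Sum>k\<le>K. c k * (\<Sum>b<n. (R ^\<^sub>m k) $$ (a, b) * x $ b))"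
      using mult_mat_vec_index_sum[OF pow_carrier_mat[OF R] x \<open>a < n\<close>] by simp
    also have "\<dots> = (\<Sum>b<n. (\<Sum>k\<le>K. c k * (R ^\<^sub>m k) $$ (a, b)) * x $ b)"
      unfolding sum_distrib_left sum_distrib_right by (subst sum.swap) (simp add: mult_ac)
    also have "\<dots> = (\<Sum>b<n. H m u a b * x $ b)"
    proof (intro sum.cong refl arg_cong2[of _ _ _ _ "(*)"])
      fix b assume "b \<in> {..<n}"
      then show "(\<Sum>k\<le>K. c k * (R ^\<^sub>m k) $$ (a, b)) = H m u a b"
        using \<open>a < n\<close> unfolding H_def h_def sum_distrib_right
        by (subst sum.swap) (simp add: um sum_distrib_left mult_ac)
    qed
    finally show ?thesis .
  qed
  have "(\<Sum>a<n. ((\<Sum>k\<le>K. c k * (S ^\<^sub>m k *\<^sub>v x) $ a) - (\<Sum>k\<le>K. c k * (S' ^\<^sub>m k *\<^sub>v x) $ a))\<^sup>2)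
    = (\<Sum>a<n. (\<Sum>b<n. (H m u a b - H l v a b) * x $ b)\<^sup>2)"
    using filter[OF S(1) _ um] filter[OF S'(1) _ vl]
    by (simp add: left_diff_distrib sum_subtractf)
  also have "\<dots> \<le> (\<Sum>a<n. \<Sum>b<n. (H m u a b - H l v a b)\<^sup>2) * (x \<bullet> x)"
    using matrix_vector_le_frobenius[of "\<lambda>a b. H m u a b - H l v a b" "($) x" n]
    by (simp add: scalar_prod_sum_lessThan[OF x] power2_eq_square)
  also have "(\<Sum>a<n. \<Sum>b<n. (H m u a b - H l v a b)\<^sup>2) =
      (\<Sum>i<n. \<Sum>j<n. ((h (m i) - h (l j)) * (\<Sum>l<n. u i l * v j l))\<^sup>2)"
    by (rule frobenius_spectral_difference[OF u(1) v(1)]) (simp add: H_def)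
  also have "\<dots> \<le> (\<Sum>i<n. \<Sum>j<n. P\<^sup>2 * ((m i - l j) * (\<Sum>l<n. u i l * v j l))\<^sup>2)"
  proof (intro sum_mono)
    fix i j assume "i \<in> {..<n}" "j \<in> {..<n}"
    then have "m i \<in> I" "l j \<in> I" using u(2) v(2) eig by auto
    then have "\<bar>h (m i) - h (l j)\<bar> \<le> P * \<bar>m i - l j\<bar>"
      using lipschitz_onD[OF lip] by (simp add: h_def dist_real_def)
    then have "(h (m i) - h (l j))\<^sup>2 \<le> (P * \<bar>m i - l j\<bar>)\<^sup>2"
      using abs_le_square_iff by fastforce
    then show "((h (m i) - h (l j)) * (\<Sum>l<n. u i l * v j l))\<^sup>2
        \<le> P\<^sup>2 * ((m i - l j) * (\<Sum>l<n. u i l * v j l))\<^sup>2"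
      unfolding power_mult_distrib power2_abs mult.assoc[symmetric]
      by (rule mult_right_mono) simp
  qed
  \<comment> \<open>The same identity read backwards, with the eigenvalues themselves in place of
    their images under \<open>h\<close>; first powers give the entries of \<open>S\<close> and
    \<open>S'\<close>.\<close>
  also have "\<dots> = P\<^sup>2 * (\<Sum>a<n. \<Sum>b<n. (S $$ (a, b) - S' $$ (a, b))\<^sup>2)"
  proof -
    have "S $$ (a, b) - S' $$ (a, b) = (\<Sum>i<n. m i * u i a * u i b) - (\<Sum>j<n. l j * v j a * v j b)"
      if "a < n" "b < n" for a b
      using um[OF that, of 1] vl[OF that, of 1] S(1) S'(1) by simp
    from frobenius_spectral_difference[OF u(1) v(1) this]
    show ?thesis by (simp add: sum_distrib_left)
  qed
  finally show ?thesis by (simp add: mult_right_mono scalar_prod_sum_lessThan[OF x] sum_nonneg)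
qed

section \<open>Kronecker filters\<close>

lemma sum_lessThan_mult:
  fixes f :: "nat \<Rightarrow> 'a::comm_monoid_add"
  shows "(\<Sum>k<p * q. f k) = (\<Sum>t<p. \<Sum>i<q. f (t * q + i))"
proof -
  have "sum f {t * q..<t * q + q} = (\<Sum>i<q. f (t * q + i))" for t
    using sum.shift_bounds_nat_ivl[of f 0 "t * q" q] by (simp add: atLeast0LessThan add.commute)
  then show ?thesis by (simp add: sum.nat_group[symmetric])
qed

lemma kron_carrier [simp]:
  "A \<in> carrier_mat p p' \<Longrightarrow> B \<in> carrier_mat q q' \<Longrightarrow> A \<otimes>\<^sub>k B \<in> carrier_mat (p * q) (p' * q')"
  by (auto simp: kron_def)

lemma kron_index:
  assumes "A \<in> carrier_mat p p'" "B \<in> carrier_mat q q'" "i < p * q" "j < p' * q'"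
  shows "(A \<otimes>\<^sub>k B) $$ (i, j) = A $$ (i div q, j div q') * B $$ (i mod q, j mod q')"
  using assms by (auto simp: kron_def)

lemma block_index_less: "t < p \<Longrightarrow> i < q \<Longrightarrow> t * q + i < p * (q :: nat)"
proof -
  assume "t < p" "i < q"
  then have "t * q + i < Suc t * q" by simp
  also have "\<dots> \<le> p * q" using \<open>t < p\<close> by (intro mult_le_mono1) simp
  finally show ?thesis .
qed

lemma div_mod_less:
  assumes "i < p * (q :: nat)"
  shows "i div q < p" "i mod q < q"
  using assms by (cases "q = 0"; simp add: less_mult_imp_div_less)+

lemma kron_index_block:
  assumes "A \<in> carrier_mat p p'" "B \<in> carrier_mat q q'" "s < p" "i < q" "t < p'" "j < q'"
  shows "(A \<otimes>\<^sub>k B) $$ (s * q + i, t * q' + j) = A $$ (s, t) * B $$ (i, j)"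
  using kron_index[OF assms(1,2) block_index_less block_index_less, OF assms(3-6)] assms(3-6)
  by simp

text \<open>The summation index is \<open>t * q' + l\<close>, so the sum is a double sum whose terms
  split into a factor in \<open>t\<close> and a factor in \<open>l\<close>.\<close>

lemma kron_mult_distrib:
  assumes A: "A \<in> carrier_mat p p'" and C: "C \<in> carrier_mat p' p''"
    and B: "B \<in> carrier_mat q q'" and D: "D \<in> carrier_mat q' q''"
  shows "(A * C) \<otimes>\<^sub>k (B * D) = (A \<otimes>\<^sub>k B) * (C \<otimes>\<^sub>k D)"
proof (rule eq_matI)
  fix i j assume "i < dim_row ((A \<otimes>\<^sub>k B) * (C \<otimes>\<^sub>k D))" "j < dim_col ((A \<otimes>\<^sub>k B) * (C \<otimes>\<^sub>k D))"
  then have i: "i < p * q" and j: "j < p'' * q''" using assms by (simp_all add: kron_def)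
  note dm = div_mod_less[OF i] div_mod_less[OF j]
  have "((A \<otimes>\<^sub>k B) * (C \<otimes>\<^sub>k D)) $$ (i, j) =
      (\<Sum>t<p'. \<Sum>l<q'. (A \<otimes>\<^sub>k B) $$ (i, t * q' + l) * (C \<otimes>\<^sub>k D) $$ (t * q' + l, j))"
    by (simp add: mult_mat_index_sum[OF kron_carrier[OF A B] kron_carrier[OF C D] i j]
        sum_lessThan_mult)
  also have "\<dots> = (\<Sum>t<p'. \<Sum>l<q'. (A $$ (i div q, t) * C $$ (t, j div q'')) *
      (B $$ (i mod q, l) * D $$ (l, j mod q'')))"
    using kron_index[OF A B i block_index_less] kron_index[OF C D block_index_less j]
    by (intro sum.cong refl) simp
  also have "\<dots> = (A * C) $$ (i div q, j div q'') * (B * D) $$ (i mod q, j mod q'')"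
    using dm by (simp add: mult_mat_index_sum[OF A C] mult_mat_index_sum[OF B D] sum_product)
  also have "\<dots> = ((A * C) \<otimes>\<^sub>k (B * D)) $$ (i, j)"
    using kron_index[OF mult_carrier_mat[OF A C] mult_carrier_mat[OF B D] i j] by simp
  finally show "((A * C) \<otimes>\<^sub>k (B * D)) $$ (i, j) = ((A \<otimes>\<^sub>k B) * (C \<otimes>\<^sub>k D)) $$ (i, j)" by simp
qed (use assms in \<open>simp_all add: kron_def\<close>)

lemma kron_one: "1\<^sub>m p \<otimes>\<^sub>k 1\<^sub>m q = 1\<^sub>m (p * q)"
proof (rule eq_matI)
  fix i j assume "i < dim_row (1\<^sub>m (p * q) :: rmat)" "j < dim_col (1\<^sub>m (p * q) :: rmat)"
  then have i: "i < p * q" and j: "j < p * q" by simp_all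
  have "i = j" if "i div q = j div q" "i mod q = j mod q"
    using that by (metis div_mult_mod_eq)
  then show "(1\<^sub>m p \<otimes>\<^sub>k 1\<^sub>m q) $$ (i, j) = 1\<^sub>m (p * q) $$ (i, j)"
    using div_mod_less[OF i] div_mod_less[OF j] i j
    by (subst kron_index[OF one_carrier_mat one_carrier_mat]) auto
qed (simp_all add: kron_def)

text \<open>Turns every branch of the filter into a polynomial in the single matrix
  \<open>A \<otimes>\<^sub>k B\<close>, to which the Lipschitz bound applies.\<close>

lemma kron_pow:
  assumes A: "A \<in> carrier_mat p p" and B: "B \<in> carrier_mat q q"
  shows "(A ^\<^sub>m k) \<otimes>\<^sub>k (B ^\<^sub>m k) = (A \<otimes>\<^sub>k B) ^\<^sub>m k"
proof (induction k)
  case 0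
  then show ?case using A B kron_one by (simp add: kron_def)
next
  case (Suc k)
  then show ?case
    using kron_mult_distrib[OF pow_carrier_mat[OF A] A pow_carrier_mat[OF B] B] by simp
qed

text \<open>The difference is the Kronecker product of \<open>A\<close> with \<open>B - B'\<close>,
  and the Frobenius norm is multiplicative over such products.\<close>

lemma kron_frobenius_difference:
  assumes A: "A \<in> carrier_mat p p" and B: "B \<in> carrier_mat q q" "B' \<in> carrier_mat q q"
  shows "(\<Sum>i<p * q. \<Sum>j<p * q. ((A \<otimes>\<^sub>k B) $$ (i, j) - (A \<otimes>\<^sub>k B') $$ (i, j))\<^sup>2)
    = (\<Sum>s<p. \<Sum>t<p. (A $$ (s, t))\<^sup>2) * (\<Sum>i<q. \<Sum>j<q. (B $$ (i, j) - B' $$ (i, j))\<^sup>2)"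
proof -
  have "(\<Sum>i<p * q. \<Sum>j<p * q. ((A \<otimes>\<^sub>k B) $$ (i, j) - (A \<otimes>\<^sub>k B') $$ (i, j))\<^sup>2)
    = (\<Sum>s<p. \<Sum>i<q. \<Sum>t<p. \<Sum>j<q. (A $$ (s, t))\<^sup>2 * (B $$ (i, j) - B' $$ (i, j))\<^sup>2)"
    unfolding sum_lessThan_mult
    using kron_index_block[OF A B(1)] kron_index_block[OF A B(2)]
    by (intro sum.cong refl) (simp add: power_mult_distrib flip: right_diff_distrib)
  also have "\<dots> = (\<Sum>s<p. \<Sum>t<p. \<Sum>i<q. \<Sum>j<q. (A $$ (s, t))\<^sup>2 * (B $$ (i, j) - B' $$ (i, j))\<^sup>2)"
    by (intro sum.cong refl sum.swap)
  finally show ?thesis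
    by (simp add: sum_distrib_right flip: sum_distrib_left)
qed

lemma sum_power2_le_card_mult:
  fixes f :: "'a \<Rightarrow> real"
  shows "(\<Sum>i\<in>I. f i)\<^sup>2 \<le> real (card I) * (\<Sum>i\<in>I. (f i)\<^sup>2)"
  using Cauchy_Schwarz_ineq_sum[of f "\<lambda>_. 1" I] by (simp add: mult.commute)

lemma L2_set_sum_le: "L2_set (\<lambda>a. \<Sum>r\<in>R. y r a) A \<le> (\<Sum>r\<in>R. L2_set (y r) A)"
proof (induction R rule: infinite_finite_induct)
  case (insert r R)
  then show ?case
    using L2_set_triangle_ineq[of "y r" "\<lambda>a. \<Sum>r\<in>R. y r a" A] by simp
qed (simp_all add: L2_set_def)

lemma scalar_prod_self_nonneg: "0 \<le> (x :: rvec) \<bullet> x"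
  by (simp add: scalar_prod_def sum_nonneg)

lemma l2_norm_eq_L2_set: "l2_norm v = L2_set (($) v) {..<dim_vec v}"
  by (simp add: l2_norm_def L2_set_def scalar_prod_def lessThan_atLeast0 power2_eq_square)

section \<open>The temporal and spatial factors of the pairs\<close>

lemma temporal_carrier [simp]: "temporal T r \<in> carrier_mat T T"
  by (rule carrier_matI) (simp_all add: temporal_def shift_mat_def Let_def)

lemma spatial_carrier [simp]: "c (r div 2) \<in> carrier_mat N N \<Longrightarrow> spatial c r \<in> carrier_mat N N"
  by (rule carrier_matI) (auto simp: spatial_def sym_part_def skew_part_def)

lemma temporal_index:
  assumes "s < T" "t < T"
  shows "temporal T r $$ (s, t) =
    (if r = 1 then if s = t then 1 else 0
     else (if even r then 1 else - 1) * (if t = s + r div 2 then 1 else 0)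
       + (if s = t + r div 2 then 1 else 0))"
  using assms by (auto simp: temporal_def shift_mat_def Let_def)

lemma spatial_index:
  assumes "c (r div 2) \<in> carrier_mat N N" "i < N" "j < N"
  shows "spatial c r $$ (i, j) =
    (if r = 1 then c 0 $$ (i, j)
     else (c (r div 2) $$ (i, j) + (if even r then 1 else - 1) * c (r div 2) $$ (j, i)) / 2)"
  using assms by (auto simp: spatial_def sym_part_def skew_part_def)

text \<open>Each of the two shifted diagonals carries at most \<open>T\<close> ones, and for a
  positive lag they are disjoint. The bound on \<open>r\<close> excludes \<open>r = 0\<close>, where
  \<open>temporal\<close> would be twice the identity.\<close>

lemma temporal_frobenius:
  assumes "1 \<le> r"
  shows "(\<Sum>s<T. \<Sum>t<T. (temporal T r $$ (s, t))\<^sup>2) \<le> 2 * real T"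
proof -
  define \<tau> where "\<tau> = r div 2"
  have "(temporal T r $$ (s, t))\<^sup>2 \<le> (if t = s + \<tau> then 1 else 0) + (if s = t + \<tau> then 1 else 0)"
    if "s < T" "t < T" for s t
  proof (cases "r = 1")
    case False
    then have "\<tau> > 0" using assms by (simp add: \<tau>_def)
    then show ?thesis using that False by (auto simp: temporal_index \<tau>_def)
  qed (use that in \<open>auto simp: temporal_index \<tau>_def\<close>)
  then have "(\<Sum>s<T. \<Sum>t<T. (temporal T r $$ (s, t))\<^sup>2)
    \<le> (\<Sum>s<T. \<Sum>t<T. (if t = s + \<tau> then 1 else 0) + (if s = t + \<tau> then 1 else 0))"
    by (intro sum_mono) auto
  also have "\<dots> = (\<Sum>s<T. \<Sum>t<T. if t = s + \<tau> then 1 else 0) + (\<Sum>t<T. \<Sum>s<T. if s = t + \<tau> then 1 else 0)"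
    unfolding sum.distrib by (subst (2) sum.swap) simp
  also have "\<dots> \<le> (\<Sum>s<T. 1) + (\<Sum>t<T. 1)"
    by (intro add_mono sum_mono) (simp_all add: sum.delta)
  finally show ?thesis by simp
qed

text \<open>Transposition multiplies both factors by the same sign \<open>sg\<close>, and the two
  signs cancel. For \<open>r = 1\<close> the spatial factor is \<open>c 0\<close> itself, whose
  symmetry is assumed.\<close>

lemma temporal_kron_spatial_symmetric:
  assumes c: "c (r div 2) \<in> carrier_mat N N"
    and sym: "\<And>i j. i < N \<Longrightarrow> j < N \<Longrightarrow> c 0 $$ (i, j) = c 0 $$ (j, i)"
  shows "symmetric_mat (temporal T r \<otimes>\<^sub>k spatial c r)"
proof -
  \<comment> \<open>The number 1 is odd but belongs to a symmetric pair.\<close>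
  define sg :: real where "sg = (if r = 1 \<or> even r then 1 else - 1)"
  have t: "temporal T r $$ (s, t) = sg * temporal T r $$ (t, s)" if "s < T" "t < T" for s t
    using that by (auto simp: temporal_index sg_def)
  have s: "spatial c r $$ (i, j) = sg * spatial c r $$ (j, i)" if "i < N" "j < N" for i j
    using that sym by (auto simp: spatial_index[of c r N, OF c] sg_def)
  have "sg * sg = 1" by (simp add: sg_def)
  note kr = kron_index[OF temporal_carrier spatial_carrier[of c r N, OF c]]
  have dims: "temporal T r \<otimes>\<^sub>k spatial c r \<in> carrier_mat (T * N) (T * N)"
    using c by simp
  have "(temporal T r \<otimes>\<^sub>k spatial c r) $$ (i, j) = (temporal T r \<otimes>\<^sub>k spatial c r) $$ (j, i)"
    if ij: "i < T * N" "j < T * N" for i j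
  proof -
    note dm = div_mod_less[OF ij(1)] div_mod_less[OF ij(2)]
    show ?thesis
      unfolding kr[OF ij] kr[OF ij(2,1)] using \<open>sg * sg = 1\<close>
      by (subst t[OF dm(1,3)], subst s[OF dm(2,4)]) (simp add: algebra_simps)
  qed
  then show ?thesis
    using dims by (auto simp: symmetric_mat_def intro!: eq_matI)
qed

text \<open>Taking the symmetric or skew-symmetric part is an orthogonal projection for the
  Frobenius inner product, hence a contraction. Entrywise this is convexity of the square, followed
  by an exchange of the two indices.\<close>

lemma spatial_frobenius_difference:
  assumes c: "c (r div 2) \<in> carrier_mat N N" and c': "c' (r div 2) \<in> carrier_mat N N"
  shows "(\<Sum>i<N. \<Sum>j<N. (spatial c r $$ (i, j) - spatial c' r $$ (i, j))\<^sup>2)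
    \<le> (\<Sum>i<N. \<Sum>j<N. (c (r div 2) $$ (i, j) - c' (r div 2) $$ (i, j))\<^sup>2)"
proof (cases "r = 1")
  case True
  then show ?thesis using c c' by (simp add: spatial_def)
next
  case False
  define d where "d = (\<lambda>i j. c (r div 2) $$ (i, j) - c' (r div 2) $$ (i, j))"
  define sg :: real where "sg = (if even r then 1 else - 1)"
  have "(spatial c r $$ (i, j) - spatial c' r $$ (i, j))\<^sup>2 \<le> ((d i j)\<^sup>2 + (d j i)\<^sup>2) / 2"
    if "i < N" "j < N" for i j
  proof -
    have "spatial c r $$ (i, j) - spatial c' r $$ (i, j) = (d i j + sg * d j i) / 2"
      using False that by (simp add: spatial_index[of c r N, OF c] spatial_index[of c' r N, OF c'] d_def sg_def)
        (auto simp: field_simps)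
    moreover have "((x + sg * y) / 2)\<^sup>2 \<le> (x\<^sup>2 + y\<^sup>2) / 2" for x y :: real
    proof -
      have "(x\<^sup>2 + y\<^sup>2) / 2 - ((x + sg * y) / 2)\<^sup>2 = ((x - sg * y) / 2)\<^sup>2"
        by (auto simp: sg_def power2_eq_square field_simps)
      then show ?thesis using zero_le_power2[of "(x - sg * y) / 2"] by linarith
    qed
    ultimately show ?thesis by (simp only:)
  qed
  then have "(\<Sum>i<N. \<Sum>j<N. (spatial c r $$ (i, j) - spatial c' r $$ (i, j))\<^sup>2)
    \<le> (\<Sum>i<N. \<Sum>j<N. ((d i j)\<^sup>2 + (d j i)\<^sup>2) / 2)"
    by (intro sum_mono) simp
  also have "\<dots> = ((\<Sum>i<N. \<Sum>j<N. (d i j)\<^sup>2) + (\<Sum>i<N. \<Sum>j<N. (d j i)\<^sup>2)) / 2"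
    by (simp add: sum.distrib flip: sum_divide_distrib)
  also have "(\<Sum>i<N. \<Sum>j<N. (d j i)\<^sup>2) = (\<Sum>i<N. \<Sum>j<N. (d i j)\<^sup>2)"
    by (rule sum.swap)
  finally show ?thesis by (simp add: d_def)
qed

text \<open>Each lag belongs to at most two pair numbers. Adding the number 0 makes the range of
  \<open>r\<close> split into \<open>T\<close> blocks of length two.\<close>

lemma sum_lag_of_pair:
  fixes q :: "nat \<Rightarrow> real"
  assumes "1 \<le> T" "\<And>\<tau>. 0 \<le> q \<tau>"
  shows "(\<Sum>r=1..2 * T - 1. q (r div 2)) \<le> 2 * (\<Sum>\<tau><T. q \<tau>)"
proof -
  have "(\<Sum>r=1..2 * T - 1. q (r div 2)) \<le> (\<Sum>r<T * 2. q (r div 2))"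
    using assms by (intro sum_mono2) auto
  also have "\<dots> = 2 * (\<Sum>\<tau><T. q \<tau>)"
  proof -
    have "(\<Sum>i<2. f i) = f 0 + f 1" for f :: "nat \<Rightarrow> real"
      by (simp add: numeral_2_eq_2)
    then show ?thesis
      unfolding sum_lessThan_mult by (simp add: sum_distrib_left)
  qed
  finally show ?thesis .
qed

text \<open>The deterministic half of the argument. The triangle inequality separates the pairs, the
  Lipschitz bound handles each one, and Cauchy-Schwarz over the pairs collects the lag errors under
  one square root.\<close>

lemma kron_filter_difference_bound:
  fixes c c' :: "nat \<Rightarrow> rmat"
  assumes T: "1 \<le> T"
    and c: "\<And>\<tau>. \<tau> < T \<Longrightarrow> c \<tau> \<in> carrier_mat N N" "\<And>\<tau>. \<tau> < T \<Longrightarrow> c' \<tau> \<in> carrier_mat N N"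
    and sym: "\<And>i j. i < N \<Longrightarrow> j < N \<Longrightarrow> c 0 $$ (i, j) = c 0 $$ (j, i)"
      "\<And>i j. i < N \<Longrightarrow> j < N \<Longrightarrow> c' 0 $$ (i, j) = c' 0 $$ (j, i)"
    and eig: "\<And>r. r \<in> {1..2 * T - 1} \<Longrightarrow> {\<gamma>. eigenvalue (temporal T r \<otimes>\<^sub>k spatial c r) \<gamma>} \<subseteq> I r"
      "\<And>r. r \<in> {1..2 * T - 1} \<Longrightarrow> {\<gamma>. eigenvalue (temporal T r \<otimes>\<^sub>k spatial c' r) \<gamma>} \<subseteq> I r"
    and lip: "\<And>r. r \<in> {1..2 * T - 1} \<Longrightarrow> P-lipschitz_on (I r) (freq_response K h r)"
    and x: "x \<in> carrier_vec (N * T)"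
  shows "l2_norm (kron_filter K (2 * T - 1) h (temporal T) (spatial c) x
        - kron_filter K (2 * T - 1) h (temporal T) (spatial c') x)
    \<le> P * (sqrt 8 * real T * sqrt (\<Sum>\<tau><T. \<Sum>i<N. \<Sum>j<N. (c \<tau> $$ (i, j) - c' \<tau> $$ (i, j))\<^sup>2)) * l2_norm x"
proof -
  define n where "n = T * N"
  define R where "R = {1..2 * T - 1}"
  define q where "q = (\<lambda>\<tau>. \<Sum>i<N. \<Sum>j<N. (c \<tau> $$ (i, j) - c' \<tau> $$ (i, j))\<^sup>2)"
  define out where "out = (\<lambda>c r a. \<Sum>k\<le>K. h k r *
    (((temporal T r ^\<^sub>m k) \<otimes>\<^sub>k (spatial c r ^\<^sub>m k)) *\<^sub>v x) $ a)"
  define y where "y = (\<lambda>r a. out c r a - out c' r a)"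
  have x': "x \<in> carrier_vec n" using x by (simp add: n_def mult.commute)
  have q_nonneg: "0 \<le> q \<tau>" for \<tau> by (simp add: q_def sum_nonneg)
  \<comment> \<open>Nonnegativity of the constant is part of \<open>lipschitz_on\<close>; pair 1
    exists because \<open>1 \<le> T\<close>.\<close>
  have P: "0 \<le> P" using lip[of 1] T lipschitz_on_nonneg by fastforce
  have y_bound: "L2_set (y r) {..<n} \<le> P * sqrt (2 * real T * q (r div 2)) * l2_norm x" if r: "r \<in> R" for r
  proof -
    have "r div 2 < T" using r T by (auto simp: R_def)
    note cr = c[OF this]
    define S where "S = temporal T r \<otimes>\<^sub>k spatial c r"
    define S' where "S' = temporal T r \<otimes>\<^sub>k spatial c' r"
    have S: "S \<in> carrier_mat n n" "S' \<in> carrier_mat n n"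
      using cr by (simp_all add: S_def S'_def n_def)
    have pow: "(temporal T r ^\<^sub>m k) \<otimes>\<^sub>k (spatial c r ^\<^sub>m k) = S ^\<^sub>m k"
      "(temporal T r ^\<^sub>m k) \<otimes>\<^sub>k (spatial c' r ^\<^sub>m k) = S' ^\<^sub>m k" for k
      using cr by (simp_all add: S_def S'_def kron_pow[of _ T _ N])
    have "(\<Sum>a<n. (y r a)\<^sup>2) \<le> P\<^sup>2 * (\<Sum>a<n. \<Sum>b<n. (S $$ (a, b) - S' $$ (a, b))\<^sup>2) * (x \<bullet> x)"
      unfolding y_def out_def pow
    proof (rule polynomial_filter_lipschitz[where I = "I r" and c = "\<lambda>k. h k r"])
      show "symmetric_mat S"
        unfolding S_def by (rule temporal_kron_spatial_symmetric[of c r N, OF cr(1) sym(1)])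
      show "symmetric_mat S'"
        unfolding S'_def by (rule temporal_kron_spatial_symmetric[of c' r N, OF cr(2) sym(2)])
      show "P-lipschitz_on (I r) (\<lambda>\<gamma>. \<Sum>k\<le>K. h k r * \<gamma> ^ k)"
        using lip r by (simp add: R_def freq_response_def[abs_def])
    qed (use S x' eig r in \<open>auto simp: S_def S'_def R_def\<close>)
    also have "(\<Sum>a<n. \<Sum>b<n. (S $$ (a, b) - S' $$ (a, b))\<^sup>2)
      = (\<Sum>s<T. \<Sum>t<T. (temporal T r $$ (s, t))\<^sup>2)
        * (\<Sum>i<N. \<Sum>j<N. (spatial c r $$ (i, j) - spatial c' r $$ (i, j))\<^sup>2)"
      unfolding S_def S'_def n_def using cr by (intro kron_frobenius_difference) simp_all
    also have "\<dots> \<le> (2 * real T) * q (r div 2)"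
      unfolding q_def using r cr
      by (intro mult_mono temporal_frobenius spatial_frobenius_difference sum_nonneg) (auto simp: R_def)
    finally have "(\<Sum>a<n. (y r a)\<^sup>2) \<le> P\<^sup>2 * (2 * real T * q (r div 2)) * (x \<bullet> x)"
      by (simp add: mult_left_mono mult_right_mono scalar_prod_self_nonneg)
    then have "L2_set (y r) {..<n} \<le> sqrt (P\<^sup>2 * (2 * real T * q (r div 2)) * (x \<bullet> x))"
      by (simp add: L2_set_def)
    also have "\<dots> = P * sqrt (2 * real T * q (r div 2)) * l2_norm x"
      using P by (simp add: real_sqrt_mult l2_norm_def)
    finally show ?thesis .
  qed
  \<comment> \<open>Origin of \<open>sqrt 8\<close>: at most 2 T pairs in Cauchy-Schwarz, a factor 2
    T from the temporal norm, and each lag counted at most twice, in all 8 T^2 under the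
    root.\<close>
  have "(\<Sum>r\<in>R. sqrt (2 * real T * q (r div 2)))\<^sup>2 \<le> real (card R) * (\<Sum>r\<in>R. 2 * real T * q (r div 2))"
    using sum_power2_le_card_mult[of "\<lambda>r. sqrt (2 * real T * q (r div 2))" R] q_nonneg by simp
  also have "\<dots> \<le> (2 * real T) * ((2 * real T) * (2 * (\<Sum>\<tau><T. q \<tau>)))"
    unfolding sum_distrib_left[symmetric]
    using sum_lag_of_pair[OF T q_nonneg] q_nonneg
    by (intro mult_mono) (auto simp: R_def intro!: sum_nonneg mult_nonneg_nonneg)
  also have "\<dots> = (sqrt 8 * real T * sqrt (\<Sum>\<tau><T. q \<tau>))\<^sup>2"
    using q_nonneg by (simp add: power_mult_distrib sum_nonneg power2_eq_square[of "real T"])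
  finally have sum_bound: "(\<Sum>r\<in>R. sqrt (2 * real T * q (r div 2))) \<le> sqrt 8 * real T * sqrt (\<Sum>\<tau><T. q \<tau>)"
    by (rule power2_le_imp_le) (simp add: sum_nonneg q_nonneg)
  have "l2_norm (kron_filter K (2 * T - 1) h (temporal T) (spatial c) x
        - kron_filter K (2 * T - 1) h (temporal T) (spatial c') x)
    = L2_set (\<lambda>a. \<Sum>r\<in>R. y r a) {..<n}"
    unfolding l2_norm_eq_L2_set using x'
    by (intro L2_set_cong) (auto simp: kron_filter_def R_def y_def out_def sum_subtractf)
  also have "\<dots> \<le> (\<Sum>r\<in>R. L2_set (y r) {..<n})" by (rule L2_set_sum_le)
  also have "\<dots> \<le> (\<Sum>r\<in>R. P * sqrt (2 * real T * q (r div 2)) * l2_norm x)"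
    by (intro sum_mono y_bound)
  also have "\<dots> = P * (\<Sum>r\<in>R. sqrt (2 * real T * q (r div 2))) * l2_norm x"
    by (simp add: sum_distrib_left sum_distrib_right)
  also have "\<dots> \<le> P * (sqrt 8 * real T * sqrt (\<Sum>\<tau><T. q \<tau>)) * l2_norm x"
    using P by (intro mult_right_mono mult_left_mono sum_bound)
      (auto simp: l2_norm_eq_L2_set L2_set_nonneg)
  finally show ?thesis by (simp add: q_def)
qed

section \<open>Moment bounds\<close>

context prob_space begin

text \<open>The new summand has mean zero and is independent of the sum so far, so the cross term
  vanishes. Integrability travels through the induction together with the value.\<close>

lemma indep_vars_second_moment_sum:
  fixes Y :: "'i \<Rightarrow> 'a \<Rightarrow> real"
  assumes "finite J" "indep_vars (\<lambda>_. borel) Y J"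
    and "\<And>i. i \<in> J \<Longrightarrow> integrable M (\<lambda>\<omega>. (Y i \<omega>)\<^sup>2)"
    and "\<And>i. i \<in> J \<Longrightarrow> expectation (Y i) = 0"
  shows "integrable M (\<lambda>\<omega>. (\<Sum>i\<in>J. Y i \<omega>)\<^sup>2) \<and>
    expectation (\<lambda>\<omega>. (\<Sum>i\<in>J. Y i \<omega>)\<^sup>2) = (\<Sum>i\<in>J. expectation (\<lambda>\<omega>. (Y i \<omega>)\<^sup>2))"
  using assms
proof (induction J rule: finite_induct)
  case (insert i J)
  have rv: "Y j \<in> borel_measurable M" if "j \<in> insert i J" for j
    using insert.prems(1) that by (auto simp: indep_vars_def)
  have int: "integrable M (Y j)" if "j \<in> insert i J" for j
    using rv[OF that] insert.prems(2)[OF that] by (rule square_integrable_imp_integrable)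
  have IH: "integrable M (\<lambda>\<omega>. (\<Sum>i\<in>J. Y i \<omega>)\<^sup>2)"
    "expectation (\<lambda>\<omega>. (\<Sum>i\<in>J. Y i \<omega>)\<^sup>2) = (\<Sum>i\<in>J. expectation (\<lambda>\<omega>. (Y i \<omega>)\<^sup>2))"
    using insert by (auto intro: indep_vars_subset)
  have indep: "indep_var borel (Y i) borel (\<lambda>\<omega>. \<Sum>i\<in>J. Y i \<omega>)"
    using insert.hyps insert.prems(1) by (rule indep_vars_sum)
  have int_sum: "integrable M (\<lambda>\<omega>. \<Sum>i\<in>J. Y i \<omega>)" using int by auto
  have cross: "integrable M (\<lambda>\<omega>. Y i \<omega> * (\<Sum>i\<in>J. Y i \<omega>))"
    "expectation (\<lambda>\<omega>. Y i \<omega> * (\<Sum>i\<in>J. Y i \<omega>)) = 0"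
    using indep_var_integrable[OF indep] indep_var_lebesgue_integral[OF indep] int int_sum
      insert.prems(3) by auto
  have "(\<Sum>i\<in>insert i J. Y i \<omega>)\<^sup>2 =
      (Y i \<omega>)\<^sup>2 + 2 * (Y i \<omega> * (\<Sum>i\<in>J. Y i \<omega>)) + (\<Sum>i\<in>J. Y i \<omega>)\<^sup>2" for \<omega>
    using insert.hyps by (simp add: power2_sum)
  then show ?case
    using insert.hyps insert.prems(2)[of i] cross IH by simp
qed simp

text \<open>After centering, the second moments add up to at most m B, which is divided by m^2. A
  variance is at most the raw second moment, so it suffices that \<open>B\<close> bounds the
  latter.\<close>

lemma sample_mean_second_moment:
  fixes Z :: "nat \<Rightarrow> 'a \<Rightarrow> real"
  assumes "1 \<le> m" and indep: "indep_vars (\<lambda>_. borel) Z {1..m}"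
    and int: "\<And>i. i \<in> {1..m} \<Longrightarrow> integrable M (\<lambda>\<omega>. (Z i \<omega>)\<^sup>2)"
    and bound: "\<And>i. i \<in> {1..m} \<Longrightarrow> expectation (\<lambda>\<omega>. (Z i \<omega>)\<^sup>2) \<le> B"
    and mean: "\<And>i. i \<in> {1..m} \<Longrightarrow> expectation (Z i) = c"
  shows "integrable M (\<lambda>\<omega>. ((\<Sum>i=1..m. Z i \<omega>) / real m - c)\<^sup>2)"
    and "expectation (\<lambda>\<omega>. ((\<Sum>i=1..m. Z i \<omega>) / real m - c)\<^sup>2) \<le> B / real m"
proof -
  define Y where "Y = (\<lambda>i \<omega>. Z i \<omega> - c)"
  have rv: "Z i \<in> borel_measurable M" if "i \<in> {1..m}" for i
    using indep that by (auto simp: indep_vars_def)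
  have Z_int: "integrable M (Z i)" if "i \<in> {1..m}" for i
    using rv[OF that] int[OF that] by (rule square_integrable_imp_integrable)
  have Y_sq: "(Y i \<omega>)\<^sup>2 = (Z i \<omega>)\<^sup>2 - 2 * c * Z i \<omega> + c\<^sup>2" for i \<omega>
    by (simp add: Y_def power2_diff)
  have Y_int: "integrable M (\<lambda>\<omega>. (Y i \<omega>)\<^sup>2)" if "i \<in> {1..m}" for i
    unfolding Y_sq using int[OF that] Z_int[OF that] by auto
  have Y_mean: "expectation (Y i) = 0" if "i \<in> {1..m}" for i
    using Z_int[OF that] mean[OF that] by (simp add: Y_def prob_space)
  have Y_bound: "expectation (\<lambda>\<omega>. (Y i \<omega>)\<^sup>2) \<le> B" if "i \<in> {1..m}" for i
  proof -
    have "expectation (\<lambda>\<omega>. (Y i \<omega>)\<^sup>2) = expectation (\<lambda>\<omega>. (Z i \<omega>)\<^sup>2) - c\<^sup>2"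
      using variance_eq[OF Z_int[OF that] int[OF that]] mean[OF that] by (simp add: Y_def)
    then show ?thesis using bound[OF that] zero_le_power2[of c] by linarith
  qed
  have "indep_vars (\<lambda>_. borel) Y {1..m}"
    unfolding Y_def by (rule indep_vars_compose2[OF indep]) simp
  from indep_vars_second_moment_sum[OF _ this Y_int Y_mean]
  have sum: "integrable M (\<lambda>\<omega>. (\<Sum>i=1..m. Y i \<omega>)\<^sup>2)"
    "expectation (\<lambda>\<omega>. (\<Sum>i=1..m. Y i \<omega>)\<^sup>2) = (\<Sum>i=1..m. expectation (\<lambda>\<omega>. (Y i \<omega>)\<^sup>2))"
    by auto
  have eq: "((\<Sum>i=1..m. Z i \<omega>) / real m - c)\<^sup>2 = (\<Sum>i=1..m. Y i \<omega>)\<^sup>2 / (real m)\<^sup>2" for \<omega>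
    using assms(1) by (simp add: Y_def sum_subtractf field_simps flip: power_divide)
  show "integrable M (\<lambda>\<omega>. ((\<Sum>i=1..m. Z i \<omega>) / real m - c)\<^sup>2)"
    unfolding eq using sum by auto
  have "(\<Sum>i=1..m. expectation (\<lambda>\<omega>. (Y i \<omega>)\<^sup>2)) \<le> (\<Sum>i=1..m. B)"
    by (intro sum_mono Y_bound)
  then have "(\<Sum>i=1..m. expectation (\<lambda>\<omega>. (Y i \<omega>)\<^sup>2)) / (real m)\<^sup>2 \<le> real m * B / (real m)\<^sup>2"
    by (intro divide_right_mono) auto
  also have "\<dots> = B / real m" using assms(1) by (simp add: power2_eq_square)
  finally show "expectation (\<lambda>\<omega>. ((\<Sum>i=1..m. Z i \<omega>) / real m - c)\<^sup>2) \<le> B / real m"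
    unfolding eq using sum by simp
qed

text \<open>The inequality of arithmetic and geometric means for the two squares gives a bound by
  the mean of the fourth powers, whatever the dependence between \<open>f\<close> and
  \<open>g\<close>.\<close>

lemma second_moment_product:
  fixes f g :: "'a \<Rightarrow> real"
  assumes [measurable]: "f \<in> borel_measurable M" "g \<in> borel_measurable M"
    and f: "integrable M (\<lambda>\<omega>. f \<omega> ^ 4)" "expectation (\<lambda>\<omega>. f \<omega> ^ 4) \<le> B"
    and g: "integrable M (\<lambda>\<omega>. g \<omega> ^ 4)" "expectation (\<lambda>\<omega>. g \<omega> ^ 4) \<le> B"
  shows "integrable M (\<lambda>\<omega>. (f \<omega> * g \<omega>)\<^sup>2)" "expectation (\<lambda>\<omega>. (f \<omega> * g \<omega>)\<^sup>2) \<le> B"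
proof -
  have le: "(f \<omega> * g \<omega>)\<^sup>2 \<le> (f \<omega> ^ 4 + g \<omega> ^ 4) / 2" for \<omega>
    using sum_squares_bound[of "(f \<omega>)\<^sup>2" "(g \<omega>)\<^sup>2"] by (simp add: power_mult_distrib flip: power_mult)
  have int: "integrable M (\<lambda>\<omega>. (f \<omega> ^ 4 + g \<omega> ^ 4) / 2)" using f g by auto
  then show sq: "integrable M (\<lambda>\<omega>. (f \<omega> * g \<omega>)\<^sup>2)"
    by (rule Bochner_Integration.integrable_bound) (use le in \<open>auto intro: order_trans[OF _ abs_ge_self]\<close>)
  have "expectation (\<lambda>\<omega>. (f \<omega> * g \<omega>)\<^sup>2) \<le> expectation (\<lambda>\<omega>. (f \<omega> ^ 4 + g \<omega> ^ 4) / 2)"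
    using sq int le by (intro integral_mono) auto
  also have "\<dots> \<le> B" using f g by simp
  finally show "expectation (\<lambda>\<omega>. (f \<omega> * g \<omega>)\<^sup>2) \<le> B" .
qed

text \<open>Convexity of the square, in the form of Cauchy-Schwarz against the constant 1. It serves
  for products taken from one stack, which may be dependent.\<close>

lemma second_moment_average:
  fixes p :: "nat \<Rightarrow> 'a \<Rightarrow> real"
  assumes "0 < n" and rv [measurable]: "\<And>t. t < n \<Longrightarrow> p t \<in> borel_measurable M"
    and int: "\<And>t. t < n \<Longrightarrow> integrable M (\<lambda>\<omega>. (p t \<omega>)\<^sup>2)"
    and bound: "\<And>t. t < n \<Longrightarrow> expectation (\<lambda>\<omega>. (p t \<omega>)\<^sup>2) \<le> B"
  shows "integrable M (\<lambda>\<omega>. ((\<Sum>t<n. p t \<omega>) / real n)\<^sup>2)"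
    "expectation (\<lambda>\<omega>. ((\<Sum>t<n. p t \<omega>) / real n)\<^sup>2) \<le> B"
proof -
  have le: "((\<Sum>t<n. p t \<omega>) / real n)\<^sup>2 \<le> (\<Sum>t<n. (p t \<omega>)\<^sup>2) / real n" for \<omega>
    using Cauchy_Schwarz_ineq_sum[of "\<lambda>t. p t \<omega>" "\<lambda>_. 1" "{..<n}"] assms(1)
    by (simp add: power_divide field_simps power2_eq_square[of "real n"])
  have int': "integrable M (\<lambda>\<omega>. (\<Sum>t<n. (p t \<omega>)\<^sup>2) / real n)"
    using int by (intro integrable_divide_zero Bochner_Integration.integrable_sum) auto
  then show sq: "integrable M (\<lambda>\<omega>. ((\<Sum>t<n. p t \<omega>) / real n)\<^sup>2)"
    by (rule Bochner_Integration.integrable_bound) (use le in \<open>auto simp: sum_nonneg\<close>)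
  have "expectation (\<lambda>\<omega>. ((\<Sum>t<n. p t \<omega>) / real n)\<^sup>2) \<le> expectation (\<lambda>\<omega>. (\<Sum>t<n. (p t \<omega>)\<^sup>2) / real n)"
    using sq int' le by (intro integral_mono) auto
  also have "\<dots> = (\<Sum>t<n. expectation (\<lambda>\<omega>. (p t \<omega>)\<^sup>2)) / real n"
    using int by simp
  also have "\<dots> \<le> (\<Sum>t<n. B) / real n"
    by (intro divide_right_mono sum_mono bound) auto
  also have "\<dots> = B" using assms(1) by simp
  finally show "expectation (\<lambda>\<omega>. ((\<Sum>t<n. p t \<omega>) / real n)\<^sup>2) \<le> B" .
qed

end

text \<open>The factor 256 is \<open>4 ^ 4\<close>, from raising
  \<open>y / 4 \<le> exp (y / 4)\<close> to the fourth power; the second exponential covers negative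
  \<open>x\<close>.\<close>

lemma power4_le_exp: "(x :: real) ^ 4 \<le> 256 * (exp x + exp (- x))"
proof -
  have pos: "y ^ 4 \<le> 256 * exp y" if "y \<ge> 0" for y :: real
  proof -
    have "y / 4 \<le> exp (y / 4)" using exp_ge_add_one_self[of "y / 4"] by linarith
    then have "(y / 4) ^ 4 \<le> exp (y / 4) ^ 4" using that by (intro power_mono) auto
    also have "exp (y / 4) ^ 4 = exp y" by (simp flip: exp_of_nat_mult)
    finally show ?thesis by (simp add: power_divide)
  qed
  show ?thesis
  proof (cases "x \<ge> 0")
    case True
    then show ?thesis using pos[OF True] exp_gt_zero[of "- x"] by (simp add: distrib_left add_increasing2)
  next
    case False
    then show ?thesis using pos[of "- x"] exp_gt_zero[of x] by (simp add: distrib_left add_increasing)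
  qed
qed

text \<open>Here 512 is twice the 256 of \<open>power4_le_exp\<close>, one for each of two
  exponentials with mean at most \<open>exp (1 / 2)\<close>.\<close>

definition fourth_moment_const :: "real \<Rightarrow> real" where
  "fourth_moment_const \<sigma> = 512 * exp (1 / 2) * \<sigma> ^ 4"

text \<open>The moment generating function is tested at plus and minus the \<open>k\<close>-th unit
  vector divided by \<open>\<sigma>\<close>, where the sub-Gaussian exponent is exactly 1/2;
  \<open>power4_le_exp\<close> is then applied to the rescaled coordinate.\<close>

lemma sub_gaussian_fourth_moment:
  assumes "sub_gaussian \<Omega> n \<sigma> X" "0 < \<sigma>" "k < n"
    and X: "\<And>\<omega>. \<omega> \<in> space \<Omega> \<Longrightarrow> X \<omega> \<in> carrier_vec n"
    and [measurable]: "(\<lambda>\<omega>. X \<omega> $ k) \<in> borel_measurable \<Omega>"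
  shows "integrable \<Omega> (\<lambda>\<omega>. (X \<omega> $ k) ^ 4)"
    and "(\<integral>\<omega>. (X \<omega> $ k) ^ 4 \<partial>\<Omega>) \<le> fourth_moment_const \<sigma>"
proof -
  have mgf: "integrable \<Omega> (\<lambda>\<omega>. exp (s * (X \<omega> $ k / \<sigma>)))"
    "(\<integral>\<omega>. exp (s * (X \<omega> $ k / \<sigma>)) \<partial>\<Omega>) \<le> exp (1 / 2)" if "s = 1 \<or> s = - 1" for s
  proof -
    define u where "u = (s / \<sigma>) \<cdot>\<^sub>v unit_vec n k"
    have u: "u \<in> carrier_vec n" by (simp add: u_def)
    have dot: "u \<bullet> X \<omega> = s * (X \<omega> $ k / \<sigma>)" if "\<omega> \<in> space \<Omega>" for \<omega>
      using X[OF that] assms(3) by (simp add: u_def)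
    have "(l2_norm u)\<^sup>2 = 1 / \<sigma>\<^sup>2"
      using that assms(2,3) by (auto simp: l2_norm_def u_def power2_eq_square)
    then have "\<sigma>\<^sup>2 * (l2_norm u)\<^sup>2 / 2 = 1 / 2" using assms(2) by simp
    moreover have "integrable \<Omega> (\<lambda>\<omega>. exp (u \<bullet> X \<omega>)) \<longleftrightarrow> integrable \<Omega> (\<lambda>\<omega>. exp (s * (X \<omega> $ k / \<sigma>)))"
      by (rule Bochner_Integration.integrable_cong) (simp_all add: dot)
    moreover have "(\<integral>\<omega>. exp (u \<bullet> X \<omega>) \<partial>\<Omega>) = (\<integral>\<omega>. exp (s * (X \<omega> $ k / \<sigma>)) \<partial>\<Omega>)"
      by (rule Bochner_Integration.integral_cong) (simp_all add: dot)
    ultimately show "integrable \<Omega> (\<lambda>\<omega>. exp (s * (X \<omega> $ k / \<sigma>)))"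
      "(\<integral>\<omega>. exp (s * (X \<omega> $ k / \<sigma>)) \<partial>\<Omega>) \<le> exp (1 / 2)"
      using assms(1) u unfolding sub_gaussian_def by auto
  qed
  define b where "b = (\<lambda>\<omega>. 256 * \<sigma> ^ 4 * (exp (1 * (X \<omega> $ k / \<sigma>)) + exp (- 1 * (X \<omega> $ k / \<sigma>))))"
  have le: "(X \<omega> $ k) ^ 4 \<le> b \<omega>" for \<omega>
  proof -
    have "(X \<omega> $ k) ^ 4 = \<sigma> ^ 4 * (X \<omega> $ k / \<sigma>) ^ 4" using assms(2) by (simp add: power_divide)
    also have "\<dots> \<le> \<sigma> ^ 4 * (256 * (exp (X \<omega> $ k / \<sigma>) + exp (- (X \<omega> $ k / \<sigma>))))"
      by (intro mult_left_mono power4_le_exp) simp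
    finally show ?thesis by (simp add: b_def mult_ac)
  qed
  have b: "integrable \<Omega> b"
    unfolding b_def using mgf(1)[of 1] mgf(1)[of "- 1"]
    by (intro integrable_mult_right Bochner_Integration.integrable_add) auto
  then show int: "integrable \<Omega> (\<lambda>\<omega>. (X \<omega> $ k) ^ 4)"
    by (rule Bochner_Integration.integrable_bound) (use le in \<open>auto intro: order_trans[OF _ abs_ge_self]\<close>)
  have "(\<integral>\<omega>. (X \<omega> $ k) ^ 4 \<partial>\<Omega>) \<le> (\<integral>\<omega>. b \<omega> \<partial>\<Omega>)"
    using int b le by (intro integral_mono) auto
  also have "\<dots> = 256 * \<sigma> ^ 4 * ((\<integral>\<omega>. exp (1 * (X \<omega> $ k / \<sigma>)) \<partial>\<Omega>)
      + (\<integral>\<omega>. exp (- 1 * (X \<omega> $ k / \<sigma>)) \<partial>\<Omega>))"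
    unfolding b_def using mgf(1)[of 1] mgf(1)[of "- 1"]
    by (subst integral_mult_right_zero, subst Bochner_Integration.integral_add) auto
  also have "\<dots> \<le> 256 * \<sigma> ^ 4 * (exp (1 / 2) + exp (1 / 2))"
    using mgf(2)[of 1] mgf(2)[of "- 1"] by (intro mult_left_mono add_mono) auto
  finally show "(\<integral>\<omega>. (X \<omega> $ k) ^ 4 \<partial>\<Omega>) \<le> fourth_moment_const \<sigma>"
    by (simp add: fourth_moment_const_def mult_ac)
qed

section \<open>Lagged covariance estimates\<close>

text \<open>The type of matrices carries no \<sigma>-algebra, so measurability is stated entrywise;
  entries of a power are polynomials in the entries of the matrix.\<close>

lemma borel_measurable_pow_mat_entry:
  fixes S :: "'w \<Rightarrow> rmat"
  assumes S: "\<And>\<omega>. S \<omega> \<in> carrier_mat n n"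
    and meas: "\<And>p q. p < n \<Longrightarrow> q < n \<Longrightarrow> (\<lambda>\<omega>. S \<omega> $$ (p, q)) \<in> borel_measurable \<Omega>"
    and "p < n" "q < n"
  shows "(\<lambda>\<omega>. (S \<omega> ^\<^sub>m k) $$ (p, q)) \<in> borel_measurable \<Omega>"
  using assms(4)
proof (induction k arbitrary: q)
  case 0
  have "(S \<omega> ^\<^sub>m 0) $$ (p, q) = (if p = q then 1 else 0)" for \<omega>
    using S[of \<omega>] assms(3) 0 by auto
  then show ?case by simp
next
  case (Suc k)
  have "(S \<omega> ^\<^sub>m Suc k) $$ (p, q) = (\<Sum>l<n. (S \<omega> ^\<^sub>m k) $$ (p, l) * S \<omega> $$ (l, q))" for \<omega>
    using mult_mat_index_sum[OF pow_carrier_mat[OF S] S assms(3) Suc.prems] by simp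
  then show ?case using Suc meas by simp
qed

lemma borel_measurable_kron_filter_entry:
  fixes B :: "'w \<Rightarrow> nat \<Rightarrow> rmat"
  assumes A: "\<And>r. r \<in> {1..R} \<Longrightarrow> A r \<in> carrier_mat T T"
    and B: "\<And>r \<omega>. r \<in> {1..R} \<Longrightarrow> B \<omega> r \<in> carrier_mat N N"
    and meas: "\<And>r i j. r \<in> {1..R} \<Longrightarrow> i < N \<Longrightarrow> j < N \<Longrightarrow>
      (\<lambda>\<omega>. B \<omega> r $$ (i, j)) \<in> borel_measurable \<Omega>"
    and x: "x \<in> carrier_vec (N * T)" and a: "a < N * T"
  shows "(\<lambda>\<omega>. kron_filter K R h A (B \<omega>) x $ a) \<in> borel_measurable \<Omega>"
proof -
  have x': "x \<in> carrier_vec (T * N)" and a': "a < T * N"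
    using x a by (simp_all add: mult.commute)
  have entry: "(((A r ^\<^sub>m k) \<otimes>\<^sub>k (B \<omega> r ^\<^sub>m k)) *\<^sub>v x) $ a =
    (\<Sum>b<T * N. (A r ^\<^sub>m k) $$ (a div N, b div N) * (B \<omega> r ^\<^sub>m k) $$ (a mod N, b mod N) * x $ b)"
    if "r \<in> {1..R}" for r k \<omega>
  proof -
    note Ak = pow_carrier_mat[OF A[OF that], of k] and Bk = pow_carrier_mat[OF B[OF that], of \<omega> k]
    show ?thesis
      unfolding mult_mat_vec_index_sum[OF kron_carrier[OF Ak Bk] x' a']
      by (intro sum.cong refl) (simp add: kron_index[OF Ak Bk a'])
  qed
  have filter: "kron_filter K R h A (B \<omega>) x $ a = (\<Sum>r=1..R. \<Sum>k\<le>K. h k r *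
    (\<Sum>b<T * N. (A r ^\<^sub>m k) $$ (a div N, b div N) * (B \<omega> r ^\<^sub>m k) $$ (a mod N, b mod N) * x $ b))" for \<omega>
    using x a by (auto simp: kron_filter_def entry)
  have "(\<lambda>\<omega>. (B \<omega> r ^\<^sub>m k) $$ (a mod N, b mod N)) \<in> borel_measurable \<Omega>"
    if "r \<in> {1..R}" "b < T * N" for r k b
    by (rule borel_measurable_pow_mat_entry[where n = N])
      (use that B meas div_mod_less[OF a'] div_mod_less[OF that(2)] in auto)
  then show ?thesis
    unfolding filter by (intro borel_measurable_sum borel_measurable_times borel_measurable_const) auto
qed

lemma lag_estimate_carrier [simp]: "lag_estimate N T S \<tau> \<in> carrier_mat N N"
  by (simp add: lag_estimate_def)

text \<open>Averaging over blocks and averaging over observations commute. With the observations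
  outermost, the estimate becomes a sample mean of quantities that each depend on a single
  observation.\<close>

lemma lag_estimate_sample_cov_index:
  assumes "i < N" "j < N"
  shows "lag_estimate N T (sample_cov (N * T) m x) \<tau> $$ (i, j) =
    (\<Sum>l=1..m. (\<Sum>t<T - \<tau>. x l $ ((t + \<tau>) * N + i) * x l $ (t * N + j)) / real (T - \<tau>)) / real m"
proof -
  define S where "S = sample_cov (N * T) m x"
  have pairs: "{(t1, t2). t1 < T \<and> t2 < T \<and> t1 = t2 + \<tau>} = (\<lambda>t. (t + \<tau>, t)) ` {..<T - \<tau>}"
    by auto
  have entry: "block N S (t + \<tau>) t $$ (i, j) =
      (\<Sum>l=1..m. x l $ ((t + \<tau>) * N + i) * x l $ (t * N + j)) / real m" if "t < T - \<tau>" for t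
    using that assms block_index_less[of "t + \<tau>" T i N] block_index_less[of t T j N]
    by (simp add: block_def S_def sample_cov_def mult.commute[of N T])
  have "lag_estimate N T S \<tau> $$ (i, j) = (\<Sum>t<T - \<tau>. block N S (t + \<tau>) t $$ (i, j)) / real (T - \<tau>)"
    using assms unfolding lag_estimate_def pairs by (simp add: sum.reindex inj_on_def)
  also have "\<dots> = (\<Sum>t<T - \<tau>. \<Sum>l=1..m. x l $ ((t + \<tau>) * N + i) * x l $ (t * N + j)) / real m / real (T - \<tau>)"
    by (simp add: entry flip: sum_divide_distrib)
  also have "(\<Sum>t<T - \<tau>. \<Sum>l=1..m. x l $ ((t + \<tau>) * N + i) * x l $ (t * N + j)) =
      (\<Sum>l=1..m. \<Sum>t<T - \<tau>. x l $ ((t + \<tau>) * N + i) * x l $ (t * N + j))"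
    by (rule sum.swap)
  finally show ?thesis
    unfolding S_def by (simp add: mult.commute flip: sum_divide_distrib)
qed

section \<open>The sampling model and its moments\<close>

lemma stack_index:
  assumes "t < T" "i < N"
  shows "stack N T y $ (t * N + i) = y t $ i"
  using assms block_index_less[of t T i N] by (simp add: stack_def mult.commute[of N T])

text \<open>Every observation may have its own process \<open>\<xi> l\<close> and starting time
  \<open>s l\<close>; what the processes share is \<open>C\<close>. Independence is required of the
  stacks as whole vectors only.\<close>

locale stationary_samples = prob_space \<Omega> for \<Omega> :: "'w measure" +
  fixes N T m :: nat and \<sigma> :: real and C :: "int \<Rightarrow> rmat"
    and \<xi> :: "nat \<Rightarrow> int \<Rightarrow> 'w \<Rightarrow> rvec" and s :: "nat \<Rightarrow> int" and X :: "nat \<Rightarrow> 'w \<Rightarrow> rvec"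
  assumes T_pos: "1 \<le> T" and m_pos: "1 \<le> m" and \<sigma>_pos: "0 < \<sigma>"
    and wss: "\<And>l. l \<in> {1..m} \<Longrightarrow> zero_mean_wss \<Omega> N (\<xi> l) C"
    and X_stack: "X = (\<lambda>l \<omega>. stack N T (\<lambda>t. \<xi> l (s l + int t) \<omega>))"
    and indep_X: "indep_vecs \<Omega> (N * T) X {1..m}"
    and sub_gaussian_X: "\<And>l. l \<in> {1..m} \<Longrightarrow> sub_gaussian \<Omega> (N * T) \<sigma> (X l)"
begin

definition estimate :: "'w \<Rightarrow> nat \<Rightarrow> rmat" where
  "estimate \<omega> = lag_estimate N T (sample_cov (N * T) m (\<lambda>l. X l \<omega>))"

text \<open>The contribution of observation \<open>l\<close> alone to entry (i, j) of the estimate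
  at lag \<open>\<tau>\<close>.\<close>

definition lag_average :: "nat \<Rightarrow> nat \<Rightarrow> nat \<Rightarrow> nat \<Rightarrow> 'w \<Rightarrow> real" where
  "lag_average \<tau> i j l \<omega> =
    (\<Sum>t<T - \<tau>. X l \<omega> $ ((t + \<tau>) * N + i) * X l \<omega> $ (t * N + j)) / real (T - \<tau>)"

lemma X_carrier: "X l \<omega> \<in> carrier_vec (N * T)"
  by (simp add: X_stack stack_def)

lemma X_index: "t < T \<Longrightarrow> i < N \<Longrightarrow> X l \<omega> $ (t * N + i) = \<xi> l (s l + int t) \<omega> $ i"
  by (simp add: X_stack stack_index)

lemma X_measurable:
  assumes "l \<in> {1..m}" "k < N * T"
  shows "(\<lambda>\<omega>. X l \<omega> $ k) \<in> borel_measurable \<Omega>"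
proof -
  have "k < T * N" using assms(2) by (simp add: mult.commute)
  note dm = div_mod_less[OF this]
  have "(\<lambda>\<omega>. \<xi> l (s l + int (k div N)) \<omega> $ (k mod N)) \<in> borel_measurable \<Omega>"
    using wss[OF assms(1)] dm(2) unfolding zero_mean_wss_def by blast
  then show ?thesis using assms(2) by (simp add: X_stack stack_def)
qed

lemma X_fourth_moment:
  assumes "l \<in> {1..m}" "k < N * T"
  shows "integrable \<Omega> (\<lambda>\<omega>. (X l \<omega> $ k) ^ 4)"
    "expectation (\<lambda>\<omega>. (X l \<omega> $ k) ^ 4) \<le> fourth_moment_const \<sigma>"
  using sub_gaussian_fourth_moment[OF sub_gaussian_X[OF assms(1)] \<sigma>_pos assms(2) X_carrier
      X_measurable[OF assms]]
  by blast+

lemma lagged_product: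
  assumes l: "l \<in> {1..m}" and t: "t < T" "t' < T" and ij: "i < N" "j < N"
  defines "f \<equiv> \<lambda>\<omega>. X l \<omega> $ (t * N + i) * X l \<omega> $ (t' * N + j)"
  shows "f \<in> borel_measurable \<Omega>" "integrable \<Omega> (\<lambda>\<omega>. (f \<omega>)\<^sup>2)"
    "expectation (\<lambda>\<omega>. (f \<omega>)\<^sup>2) \<le> fourth_moment_const \<sigma>"
    "expectation f = C (int t - int t') $$ (i, j)"
proof -
  have k: "t * N + i < N * T" "t' * N + j < N * T"
    using block_index_less[OF t(1) ij(1)] block_index_less[OF t(2) ij(2)]
    by (simp_all add: mult.commute)
  show "f \<in> borel_measurable \<Omega>"
    unfolding f_def by (intro borel_measurable_times X_measurable l k)
  show "integrable \<Omega> (\<lambda>\<omega>. (f \<omega>)\<^sup>2)" "expectation (\<lambda>\<omega>. (f \<omega>)\<^sup>2) \<le> fourth_moment_const \<sigma>"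
    unfolding f_def
    using second_moment_product[OF X_measurable[OF l k(1)] X_measurable[OF l k(2)]
        X_fourth_moment[OF l k(1)] X_fourth_moment[OF l k(2)]]
    by blast+
  have "expectation f = expectation (\<lambda>\<omega>. \<xi> l (s l + int t) \<omega> $ i * \<xi> l (s l + int t') \<omega> $ j)"
    using t ij by (simp add: f_def X_index)
  \<comment> \<open>The starting time \<open>s l\<close> cancels in the difference of the two
    times.\<close>
  also have "\<dots> = C ((s l + int t) - (s l + int t')) $$ (i, j)"
    using wss[OF l] ij unfolding zero_mean_wss_def by blast
  finally show "expectation f = C (int t - int t') $$ (i, j)" by simp
qed

text \<open>By stationarity all products in the average have the same mean, so the average is
  unbiased; its second moment obeys the bound valid for each product.\<close>

lemma lag_average_moments:
  assumes l: "l \<in> {1..m}" and "\<tau> < T" and ij: "i < N" "j < N"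
  shows "integrable \<Omega> (\<lambda>\<omega>. (lag_average \<tau> i j l \<omega>)\<^sup>2)"
    "expectation (\<lambda>\<omega>. (lag_average \<tau> i j l \<omega>)\<^sup>2) \<le> fourth_moment_const \<sigma>"
    "expectation (lag_average \<tau> i j l) = C (int \<tau>) $$ (i, j)"
proof -
  define f where "f = (\<lambda>t \<omega>. X l \<omega> $ ((t + \<tau>) * N + i) * X l \<omega> $ (t * N + j))"
  have f: "f t \<in> borel_measurable \<Omega>" "integrable \<Omega> (\<lambda>\<omega>. (f t \<omega>)\<^sup>2)"
    "expectation (\<lambda>\<omega>. (f t \<omega>)\<^sup>2) \<le> fourth_moment_const \<sigma>"
    "expectation (f t) = C (int \<tau>) $$ (i, j)" if "t < T - \<tau>" for t
    using lagged_product[OF l _ _ ij, of "t + \<tau>" t] that unfolding f_def by simp_all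
  have avg: "lag_average \<tau> i j l = (\<lambda>\<omega>. (\<Sum>t<T - \<tau>. f t \<omega>) / real (T - \<tau>))"
    by (simp add: lag_average_def f_def fun_eq_iff)
  have "0 < T - \<tau>" using assms(2) by simp
  then show "integrable \<Omega> (\<lambda>\<omega>. (lag_average \<tau> i j l \<omega>)\<^sup>2)"
    "expectation (\<lambda>\<omega>. (lag_average \<tau> i j l \<omega>)\<^sup>2) \<le> fourth_moment_const \<sigma>"
    unfolding avg using second_moment_average[of "T - \<tau>" f, OF _ f(1-3)] by blast+
  have "integrable \<Omega> (f t)" if "t < T - \<tau>" for t
    using f(1,2)[OF that] by (rule square_integrable_imp_integrable)
  then show "expectation (lag_average \<tau> i j l) = C (int \<tau>) $$ (i, j)"
    unfolding avg using f(4) assms(2) by simp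
qed

text \<open>The average is one fixed measurable function \<open>g\<close> of the coordinates of the
  stack. Since \<open>g\<close> reads only coordinates below \<open>N * T\<close>, restricting the
  stack to these changes nothing.\<close>

lemma lag_average_indep:
  assumes "i < N" "j < N"
  shows "indep_vars (\<lambda>_. borel) (lag_average \<tau> i j) {1..m}"
proof -
  define g :: "(nat \<Rightarrow> real) \<Rightarrow> real" where
    "g = (\<lambda>f. (\<Sum>t<T - \<tau>. f ((t + \<tau>) * N + i) * f (t * N + j)) / real (T - \<tau>))"
  have k: "(t + \<tau>) * N + i < N * T" "t * N + j < N * T" if "t < T - \<tau>" for t
    using that assms block_index_less[of "t + \<tau>" T i N] block_index_less[of t T j N]
    by (simp_all add: mult.commute)
  have "g \<in> borel_measurable (Pi\<^sub>M {..<N * T} (\<lambda>_. borel))"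
    unfolding g_def using k
    by (intro borel_measurable_divide borel_measurable_sum borel_measurable_times
        measurable_component_singleton borel_measurable_const) auto
  then have "indep_vars (\<lambda>_. borel) (\<lambda>l \<omega>. g (\<lambda>k\<in>{..<N * T}. X l \<omega> $ k)) {1..m}"
    using indep_X unfolding indep_vecs_def by (rule indep_vars_compose2[rotated])
  moreover have "(\<lambda>l \<omega>. g (\<lambda>k\<in>{..<N * T}. X l \<omega> $ k)) = lag_average \<tau> i j"
    using k by (auto simp: g_def lag_average_def fun_eq_iff intro!: sum.cong)
  ultimately show ?thesis by simp
qed

section \<open>The estimates and their total squared error\<close>

lemma estimate_index:
  assumes "i < N" "j < N"
  shows "estimate \<omega> \<tau> $$ (i, j) = (\<Sum>l=1..m. lag_average \<tau> i j l \<omega>) / real m"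
  using assms by (simp add: estimate_def lag_estimate_sample_cov_index lag_average_def)

lemma estimate_measurable:
  assumes "i < N" "j < N"
  shows "(\<lambda>\<omega>. estimate \<omega> \<tau> $$ (i, j)) \<in> borel_measurable \<Omega>"
proof -
  have "lag_average \<tau> i j l \<in> borel_measurable \<Omega>" if "l \<in> {1..m}" for l
    using lag_average_indep[OF assms] that by (auto simp: indep_vars_def)
  then show ?thesis
    unfolding estimate_index[OF assms]
    by (intro borel_measurable_divide borel_measurable_sum borel_measurable_const) auto
qed

lemma estimate_zero_symmetric:
  assumes "i < N" "j < N"
  shows "estimate \<omega> 0 $$ (i, j) = estimate \<omega> 0 $$ (j, i)"
  using assms by (simp add: estimate_index lag_average_def mult.commute)

lemma C_carrier: "C \<tau> \<in> carrier_mat N N"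
  using wss[of 1] m_pos by (auto simp: zero_mean_wss_def)

lemma C_zero_symmetric:
  assumes "i < N" "j < N"
  shows "C 0 $$ (i, j) = C 0 $$ (j, i)"
proof -
  have "C (0 - 0) $$ (i, j) = expectation (\<lambda>\<omega>. \<xi> 1 0 \<omega> $ i * \<xi> 1 0 \<omega> $ j)" if "i < N" "j < N" for i j
    using wss[of 1] m_pos that unfolding zero_mean_wss_def by auto
  from this[OF assms] this[OF assms(2,1)] show ?thesis by (simp add: mult.commute)
qed

text \<open>The quantity under the last square root in \<open>kron_filter_difference_bound\<close>,
  for the true lagged covariances and their estimates.\<close>

definition total_error :: "'w \<Rightarrow> real" where
  "total_error \<omega> = (\<Sum>\<tau><T. \<Sum>i<N. \<Sum>j<N. (C (int \<tau>) $$ (i, j) - estimate \<omega> \<tau> $$ (i, j))\<^sup>2)"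

lemma total_error_nonneg: "0 \<le> total_error \<omega>"
  by (simp add: total_error_def sum_nonneg)

lemma total_error_expectation:
  shows "integrable \<Omega> total_error"
    and "expectation total_error \<le> real T * (real N)\<^sup>2 * (fourth_moment_const \<sigma> / real m)"
proof -
  have entry: "integrable \<Omega> (\<lambda>\<omega>. (C (int \<tau>) $$ (i, j) - estimate \<omega> \<tau> $$ (i, j))\<^sup>2)"
    "expectation (\<lambda>\<omega>. (C (int \<tau>) $$ (i, j) - estimate \<omega> \<tau> $$ (i, j))\<^sup>2) \<le> fourth_moment_const \<sigma> / real m"
    if "\<tau> < T" "i < N" "j < N" for \<tau> i j
    unfolding estimate_index[OF that(2,3)] power2_commute[of "C (int \<tau>) $$ (i, j)"]
    using sample_mean_second_moment[OF m_pos lag_average_indep[OF that(2,3)]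
        lag_average_moments[OF _ that]] by blast+
  show "integrable \<Omega> total_error"
    unfolding total_error_def using entry(1) by (intro Bochner_Integration.integrable_sum) auto
  have "expectation total_error = (\<Sum>\<tau><T. \<Sum>i<N. \<Sum>j<N.
      expectation (\<lambda>\<omega>. (C (int \<tau>) $$ (i, j) - estimate \<omega> \<tau> $$ (i, j))\<^sup>2))"
    unfolding total_error_def using entry(1)
    by (intro trans[OF Bochner_Integration.integral_sum] Bochner_Integration.integrable_sum sum.cong refl) auto
  also have "\<dots> \<le> (\<Sum>\<tau><T. \<Sum>i<N. \<Sum>j<N. fourth_moment_const \<sigma> / real m)"
    using entry(2) by (intro sum_mono) auto
  finally show "expectation total_error \<le> real T * (real N)\<^sup>2 * (fourth_moment_const \<sigma> / real m)"
    by (simp add: power2_eq_square mult.assoc)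
qed

text \<open>Markov's inequality, with the threshold chosen so that the bound on the expectation
  divided by it is exactly \<open>\<epsilon>\<close>. The threshold must be positive, hence
  \<open>1 \<le> N\<close>.\<close>

lemma total_error_tail:
  assumes "0 < \<epsilon>" "1 \<le> N"
  shows "1 - \<epsilon> \<le> prob {\<omega> \<in> space \<Omega>.
    total_error \<omega> < real T * (real N)\<^sup>2 * fourth_moment_const \<sigma> / (real m * \<epsilon>)}"
proof -
  define a where "a = real T * (real N)\<^sup>2 * fourth_moment_const \<sigma> / (real m * \<epsilon>)"
  have "0 < a"
    using assms T_pos m_pos \<sigma>_pos by (simp add: a_def fourth_moment_const_def)
  have [measurable]: "total_error \<in> borel_measurable \<Omega>"
    using total_error_expectation(1) by auto
  have "prob {\<omega> \<in> space \<Omega>. a \<le> total_error \<omega>} \<le> expectation total_error / a"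
    using integral_Markov_inequality_measure[OF total_error_expectation(1) sets.empty_sets _ \<open>0 < a\<close>]
    by (simp add: total_error_nonneg)
  also have "\<dots> \<le> real T * (real N)\<^sup>2 * (fourth_moment_const \<sigma> / real m) / a"
    using total_error_expectation(2) \<open>0 < a\<close> by (intro divide_right_mono) auto
  also have "\<dots> = \<epsilon>"
    using assms T_pos m_pos \<sigma>_pos by (simp add: a_def fourth_moment_const_def field_simps)
  finally have "prob {\<omega> \<in> space \<Omega>. a \<le> total_error \<omega>} \<le> \<epsilon>" .
  moreover have "prob {\<omega> \<in> space \<Omega>. \<not> a \<le> total_error \<omega>} = 1 - prob {\<omega> \<in> space \<Omega>. a \<le> total_error \<omega>}"
    by (rule prob_neg) measurable
  ultimately show ?thesis by (simp add: a_def not_le)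
qed

text \<open>Makes the event in the probability bound measurable, as the monotonicity of
  \<open>prob\<close> asks of the larger event.\<close>

lemma filter_error_measurable:
  assumes "x \<in> carrier_vec (N * T)"
  shows "(\<lambda>\<omega>. l2_norm (kron_filter K (2 * T - 1) h (temporal T) B x
      - kron_filter K (2 * T - 1) h (temporal T) (spatial (estimate \<omega>)) x)) \<in> borel_measurable \<Omega>"
proof -
  have est: "estimate \<omega> \<tau> \<in> carrier_mat N N" for \<omega> \<tau> by (simp add: estimate_def)
  have dim: "dim_vec (kron_filter K (2 * T - 1) h (temporal T) B' x) = N * T" for B'
    using assms by (simp add: kron_filter_def)
  have "(\<lambda>\<omega>. kron_filter K (2 * T - 1) h (temporal T) (spatial (estimate \<omega>)) x $ a) \<in> borel_measurable \<Omega>"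
    if "a < N * T" for a
  proof (rule borel_measurable_kron_filter_entry[OF _ _ _ assms that])
    show "(\<lambda>\<omega>. spatial (estimate \<omega>) r $$ (i, j)) \<in> borel_measurable \<Omega>" if "i < N" "j < N" for r i j
      using estimate_measurable that by (simp add: spatial_index[OF est])
  qed (use est in simp_all)
  moreover have "l2_norm (kron_filter K (2 * T - 1) h (temporal T) B x
      - kron_filter K (2 * T - 1) h (temporal T) B' x) =
      sqrt (\<Sum>a<N * T. (kron_filter K (2 * T - 1) h (temporal T) B x $ a
        - kron_filter K (2 * T - 1) h (temporal T) B' x $ a)\<^sup>2)" for B'
    unfolding l2_norm_eq_L2_set L2_set_def index_minus_vec dim
    by (intro arg_cong[of _ _ sqrt] sum.cong refl) (simp add: dim del: One_nat_def)
  ultimately show ?thesis by simp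
qed

text \<open>Outside a null set, the event that the total error lies below the Markov threshold is
  contained in the event that the output bound holds, by the deterministic estimate with
  \<open>P \<omega>\<close> at that outcome.\<close>

lemma filter_error_probability:
  assumes \<epsilon>: "0 < \<epsilon>" and N: "1 \<le> N" and [measurable]: "P \<in> borel_measurable \<Omega>"
    and ae: "AE \<omega> in \<Omega>. \<forall>r\<in>{1..2 * T - 1}.
      {\<gamma>. eigenvalue (temporal T r \<otimes>\<^sub>k spatial (\<lambda>\<tau>. C (int \<tau>)) r) \<gamma>} \<subseteq> I r \<omega> \<and>
      {\<gamma>. eigenvalue (temporal T r \<otimes>\<^sub>k spatial (estimate \<omega>) r) \<gamma>} \<subseteq> I r \<omega> \<and>
      (P \<omega>)-lipschitz_on (I r \<omega>) (freq_response K h r)"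
    and x: "x \<in> carrier_vec (N * T)"
  shows "1 - \<epsilon> \<le> prob {\<omega> \<in> space \<Omega>.
    l2_norm (kron_filter K (2 * T - 1) h (temporal T) (spatial (\<lambda>\<tau>. C (int \<tau>))) x
        - kron_filter K (2 * T - 1) h (temporal T) (spatial (estimate \<omega>)) x)
      \<le> sqrt (8 * fourth_moment_const \<sigma> / \<epsilon>) * (real T powr (3 / 2) * P \<omega> * real N / sqrt (real m)) * l2_norm x}"
    (is "_ \<le> prob {\<omega> \<in> space \<Omega>. ?err \<omega> \<le> ?bound \<omega>}")
proof -
  define a where "a = real T * (real N)\<^sup>2 * fourth_moment_const \<sigma> / (real m * \<epsilon>)"
  define err where "err = ?err"
  define bound where "bound = ?bound"
  have [measurable]: "err \<in> borel_measurable \<Omega>"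
    unfolding err_def by (rule filter_error_measurable[OF x])
  have [measurable]: "bound \<in> borel_measurable \<Omega>"
    unfolding bound_def by measurable
  have powr_eq: "real T powr (3 / 2) = real T * sqrt (real T)"
    using T_pos powr_add[of "real T" 1 "1 / 2"] by (simp add: powr_half_sqrt)
  \<comment> \<open>The factor \<open>T\<close> of the deterministic bound times
    \<open>sqrt T\<close> from \<open>sqrt a\<close> gives the power 3/2; \<open>N\<close>, the
    sample size and the constant come out of \<open>sqrt a\<close> as well.\<close>
  have bound_eq: "P \<omega> * (sqrt 8 * real T * sqrt a) * l2_norm x = bound \<omega>" for \<omega>
    by (simp add: bound_def a_def powr_eq real_sqrt_mult real_sqrt_divide mult_ac)
  have "1 - \<epsilon> \<le> prob {\<omega> \<in> space \<Omega>. total_error \<omega> < a}"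
    unfolding a_def by (rule total_error_tail[OF \<epsilon> N])
  also have "\<dots> \<le> prob {\<omega> \<in> space \<Omega>. err \<omega> \<le> bound \<omega>}"
  proof (rule finite_measure_mono_AE)
    show "{\<omega> \<in> space \<Omega>. err \<omega> \<le> bound \<omega>} \<in> sets \<Omega>" by measurable
    show "AE \<omega> in \<Omega>. \<omega> \<in> {\<omega> \<in> space \<Omega>. total_error \<omega> < a} \<longrightarrow> \<omega> \<in> {\<omega> \<in> space \<Omega>. err \<omega> \<le> bound \<omega>}"
      using ae
    proof eventually_elim
      case (elim \<omega>)
      have "err \<omega> \<le> P \<omega> * (sqrt 8 * real T * sqrt (total_error \<omega>)) * l2_norm x"
        unfolding total_error_def err_def
      proof (rule kron_filter_difference_bound[OF T_pos _ _ _ _ _ _ _ x, where I = "\<lambda>r. I r \<omega>"])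
        show "estimate \<omega> \<tau> \<in> carrier_mat N N" for \<tau> by (simp add: estimate_def)
      qed (use elim C_carrier C_zero_symmetric estimate_zero_symmetric in auto)
      \<comment> \<open>The sign is needed to replace the total error by the larger \<open>a\<close>
        inside the product.\<close>
      moreover have "0 \<le> P \<omega>"
      proof -
        have "1 \<in> {1..2 * T - 1}" using T_pos by simp
        then have "(P \<omega>)-lipschitz_on (I 1 \<omega>) (freq_response K h 1)" using elim by blast
        then show ?thesis by (rule lipschitz_on_nonneg)
      qed
      ultimately have "err \<omega> \<le> P \<omega> * (sqrt 8 * real T * sqrt a) * l2_norm x" if "total_error \<omega> < a"
        using that
        by (elim order_trans) (intro mult_right_mono mult_left_mono;
          simp add: l2_norm_eq_L2_set L2_set_nonneg)
      then show ?case unfolding bound_eq by blast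
    qed
  qed
  finally show ?thesis by (simp only: err_def bound_def)
qed

end

text \<open>The rate in probability is expressed by fixing \<open>c\<close> before the probability
  space, the dimensions, the sample size and the filter, so that it depends on
  \<open>\<sigma>\<close> and \<open>\<epsilon>\<close> only. \<open>P\<close> and \<open>I\<close>
  may vary with the outcome, since the intervals have to contain eigenvalues of random
  matrices.\<close>

theorem theorem1:
  fixes \<sigma> :: real
  assumes "0 < \<sigma>"
  shows "\<forall>\<epsilon>>0. \<exists>c>0.
    \<forall>(\<Omega> :: 'w measure) (N :: nat) (T :: nat) (M :: nat) (K :: nat)
      (C :: int \<Rightarrow> rmat) (\<xi> :: nat \<Rightarrow> int \<Rightarrow> 'w \<Rightarrow> rvec) (s :: nat \<Rightarrow> int)
      (X :: nat \<Rightarrow> 'w \<Rightarrow> rvec) (Chat :: 'w \<Rightarrow> nat \<Rightarrow> rmat)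
      (A :: nat \<Rightarrow> rmat) (B :: nat \<Rightarrow> rmat) (Bhat :: 'w \<Rightarrow> nat \<Rightarrow> rmat)
      (h :: nat \<Rightarrow> nat \<Rightarrow> real) (P :: 'w \<Rightarrow> real) (I :: nat \<Rightarrow> 'w \<Rightarrow> real set) (x :: rvec).
      prob_space \<Omega> \<and> 1 \<le> N \<and> 1 \<le> T \<and> N * T < M \<and>
      (\<forall>m\<in>{1..M}. zero_mean_wss \<Omega> N (\<xi> m) C) \<and>
      X = (\<lambda>m \<omega>. stack N T (\<lambda>t. \<xi> m (s m + int t) \<omega>)) \<and>
      indep_vecs \<Omega> (N * T) X {1..M} \<and>
      (\<forall>m\<in>{1..M}. sub_gaussian \<Omega> (N * T) \<sigma> (X m)) \<and>
      Chat = (\<lambda>\<omega>. lag_estimate N T (sample_cov (N * T) M (\<lambda>m. X m \<omega>))) \<and>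
      A = temporal T \<and>
      B = spatial (\<lambda>\<tau>. C (int \<tau>)) \<and>
      Bhat = (\<lambda>\<omega>. spatial (Chat \<omega>)) \<and>
      P \<in> borel_measurable \<Omega> \<and>
      (AE \<omega> in \<Omega>. \<forall>r\<in>{1..2 * T - 1}.
         is_interval (I r \<omega>) \<and>
         {\<gamma>. eigenvalue (A r \<otimes>\<^sub>k B r) \<gamma>} \<subseteq> I r \<omega> \<and>
         {\<gamma>. eigenvalue (A r \<otimes>\<^sub>k Bhat \<omega> r) \<gamma>} \<subseteq> I r \<omega> \<and>
         (P \<omega>)-lipschitz_on (I r \<omega>) (freq_response K h r)) \<and>
      x \<in> carrier_vec (N * T)
      \<longrightarrow>
      1 - \<epsilon> \<le> measure \<Omega> {\<omega> \<in> space \<Omega>.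
        l2_norm (kron_filter K (2 * T - 1) h A B x - kron_filter K (2 * T - 1) h A (Bhat \<omega>) x)
          \<le> c * (real T powr (3 / 2) * P \<omega> * real N / sqrt (real M)) * l2_norm x}"
proof (intro allI impI, goal_cases)
  case (1 \<epsilon>)
  note \<epsilon> = 1
  define c where "c = sqrt (8 * fourth_moment_const \<sigma> / \<epsilon>)"
  have c: "0 < c" using assms \<epsilon> by (simp add: c_def fourth_moment_const_def)
  show ?case
  proof (intro exI[of _ c] conjI allI impI, goal_cases)
    case 1
    show ?case by (fact c)
  next
    case (2 \<Omega> N T M K C \<xi> s X Chat A B Bhat h P I x)
    then have *: "prob_space \<Omega>" "1 \<le> N" "1 \<le> T" "N * T < M"
      "\<And>l. l \<in> {1..M} \<Longrightarrow> zero_mean_wss \<Omega> N (\<xi> l) C"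
      "X = (\<lambda>l \<omega>. stack N T (\<lambda>t. \<xi> l (s l + int t) \<omega>))"
      "indep_vecs \<Omega> (N * T) X {1..M}"
      "\<And>l. l \<in> {1..M} \<Longrightarrow> sub_gaussian \<Omega> (N * T) \<sigma> (X l)"
      by blast+
    interpret stationary_samples \<Omega> N T M \<sigma> C \<xi> s X
      using * assms by (simp add: stationary_samples_def stationary_samples_axioms_def)
    have "Chat = estimate"
      using 2 unfolding estimate_def[abs_def] by blast
    then have eqs: "A = temporal T" "B = spatial (\<lambda>\<tau>. C (int \<tau>))" "Bhat = (\<lambda>\<omega>. spatial (estimate \<omega>))"
      using 2 by blast+
    have "AE \<omega> in \<Omega>. \<forall>r\<in>{1..2 * T - 1}.
      is_interval (I r \<omega>) \<and>
      {\<gamma>. eigenvalue (A r \<otimes>\<^sub>k B r) \<gamma>} \<subseteq> I r \<omega> \<and>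
      {\<gamma>. eigenvalue (A r \<otimes>\<^sub>k Bhat \<omega> r) \<gamma>} \<subseteq> I r \<omega> \<and>
      (P \<omega>)-lipschitz_on (I r \<omega>) (freq_response K h r)"
      using 2 by blast
    then have ae: "AE \<omega> in \<Omega>. \<forall>r\<in>{1..2 * T - 1}.
      {\<gamma>. eigenvalue (temporal T r \<otimes>\<^sub>k spatial (\<lambda>\<tau>. C (int \<tau>)) r) \<gamma>} \<subseteq> I r \<omega> \<and>
      {\<gamma>. eigenvalue (temporal T r \<otimes>\<^sub>k spatial (estimate \<omega>) r) \<gamma>} \<subseteq> I r \<omega> \<and>
      (P \<omega>)-lipschitz_on (I r \<omega>) (freq_response K h r)"
      unfolding eqs by eventually_elim blast
    have "P \<in> borel_measurable \<Omega>" "x \<in> carrier_vec (N * T)" using 2 by blast+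
    from filter_error_probability[OF \<epsilon> *(2) this(1) ae this(2)]
    show ?case unfolding eqs c_def .
  qed
qed

end
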